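(* Let $\mathfrak F$ be a free filter on $\mathbb N$. Then: (i) For every infinite-dimensional real Banach space $X$ and every $\mathfrak F$-basis $(u_n)$ of $X$ with continuous coordinate functionals, the sequence $(\|S_n\|)_{n\in\mathbb N}$ of norms of the corresponding partial sums operators is $(\mathfrak F,1)$-admissible. (ii) If $X=\ell_2$, then for every $\mathfrak F$-basis $(u_n)$ of $X$ with continuous coordinate functionals the sequence $(\|S_n\|)_{n\in\mathbb N}$ is $(\mathfrak F,2)$-admissible. (iii) If $X=\ell_p$ with $1<p<2$, then for every $\mathfrak F$-basis $(u_n)$ of $X$ with continuous coordinate functionals the sequence $(\|S_n\|)_{n\in\mathbb N}$ is $(\mathfrak F,s)$-admissible for all $s\in[1,p)$.
   Context: All Banach spaces (including $\ell_p$) are real. A filter $\mathfrak F$ on $\mathbb N$ is a non-empty family of subsets of $\mathbb N$ with $\emptyset\notin\mathfrak F$, closed under finite intersections and supersets; it is free if it contains every subset of $\mathbb N$ with finite complement. A set $I\subset\mathbb N$ is $\mathfrak F$-stationary if $I\cap A\ne\emptyset$ for every $A\in\mathfrak F$. A sequence $(x_n)$ in a topological space is $\mathfrak F$-convergent to $x$ if $\{n\in\mathbb N:x_n\in U\}\in\mathfrak F$ for every neighborhood $U$ of $x$. For $1\le q\le 2$, a sequence $(a_n)_{n\in\mathbb N}$ of positive reals is $(\mathfrak F,q)$-admissible if $\sum_{n\in I}a_n^{-q}=\infty$ for every $\mathfrak F$-stationary set $I$. $\mathfrak F$-basis: a sequence $(u_k)_{k\in\mathbb N}$ in a Banach space $X$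 is an $\mathfrak F$-basis of $X$ if for every $x\in X$ there is a unique sequence of scalars $(c_k)$ such that the partial sums $\sum_{k=1}^n c_k u_k$ are $\mathfrak F$-convergent (in $n$) in norm to $x$. The coordinate functionals are $u_k^*:x\mapsto c_k$, and the partial sums operators are $S_n(x)=\sum_{k=1}^n u_k^*(x)u_k$, with operator norm $\|S_n\|$. *)

theory Defs
  imports "HOL-Analysis.Analysis" "HOL-Library.Function_Algebras"
begin

text \<open>Real-valued functions with pointwise operations form a real vector space; the spaces
  \<open>\<ell>\<^sub>p\<close> below are subspaces of the space of all real sequences.\<close>

instantiation "fun" :: (type, real_vector) real_vector
begin

definition "scaleR_fun a f = (\<lambda>i. a *\<^sub>R f i)"

instance
  by intro_classes (auto simp: fun_eq_iff scaleR_fun_def scaleR_left.add scaleR_right.add)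

end

section \<open>Banach spaces given by a carrier and a norm\<close>

text \<open>A type cannot depend on the real number \<open>p\<close>, so \<open>\<ell>\<^sub>p\<close> for variable \<open>p\<close> is not an instance of
  the class \<^class>\<open>banach\<close>. Banach spaces are therefore pairs of a linear subspace \<open>V\<close> and a norm
  \<open>nrm\<close> on it; values of \<open>nrm\<close> outside \<open>V\<close> are irrelevant. The class-based
  notion is the case of carrier \<^const>\<open>UNIV\<close> and \<^const>\<open>norm\<close>.\<close>

definition norm_on :: "'a::real_vector set \<Rightarrow> ('a \<Rightarrow> real) \<Rightarrow> bool" where
  "norm_on V nrm \<longleftrightarrow>
     (\<forall>x\<in>V. 0 \<le> nrm x) \<and>
     (\<forall>x\<in>V. nrm x = 0 \<longleftrightarrow> x = 0) \<and>
     (\<forall>x\<in>V. \<forall>a. nrm (a *\<^sub>R x) = \<bar>a\<bar> * nrm x) \<and>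
     (\<forall>x\<in>V. \<forall>y\<in>V. nrm (x + y) \<le> nrm x + nrm y)"

text \<open>The locale \<open>Metric_space\<close> asks for symmetry and nonnegativity of the distance also outside
  the carrier, hence the default value 0 there.\<close>

definition norm_dist :: "'a::real_vector set \<Rightarrow> ('a \<Rightarrow> real) \<Rightarrow> 'a \<Rightarrow> 'a \<Rightarrow> real" where
  "norm_dist V nrm x y = (if x \<in> V \<and> y \<in> V then nrm (x - y) else 0)"

definition norm_topology :: "'a::real_vector set \<Rightarrow> ('a \<Rightarrow> real) \<Rightarrow> 'a topology" where
  "norm_topology V nrm = Metric_space.mtopology V (norm_dist V nrm)"

definition banach_on :: "'a::real_vector set \<Rightarrow> ('a \<Rightarrow> real) \<Rightarrow> bool" where
  "banach_on V nrm \<longleftrightarrow>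
     subspace V \<and> norm_on V nrm \<and> Metric_space.mcomplete V (norm_dist V nrm)"

definition infinite_dimensional :: "'a::real_vector set \<Rightarrow> bool" where
  "infinite_dimensional V \<longleftrightarrow> \<not> (\<exists>B. finite B \<and> B \<subseteq> V \<and> span B = V)"

definition onorm_on :: "'a::real_vector set \<Rightarrow> ('a \<Rightarrow> real) \<Rightarrow> ('a \<Rightarrow> 'a) \<Rightarrow> real" where
  "onorm_on V nrm T = (SUP x\<in>V. nrm (T x) / nrm x)"

lemma Metric_space_norm_dist:
  assumes "subspace V" "norm_on V nrm"
  shows "Metric_space V (norm_dist V nrm)"
proof
  fix x y z
  note N = assms(2)[unfolded norm_on_def]
  note nonneg = N[THEN conjunct1, rule_format]
  note zero = N[THEN conjunct2, THEN conjunct1, rule_format]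
  note scale = N[THEN conjunct2, THEN conjunct2, THEN conjunct1, rule_format]
  note triangle = N[THEN conjunct2, THEN conjunct2, THEN conjunct2, rule_format]
  note diff = subspace_diff[OF assms(1)]
  have minus: "nrm (y - x) = nrm (x - y)" if "x \<in> V" "y \<in> V"
    using scale[OF diff[OF that], of "-1"] by simp
  show "0 \<le> norm_dist V nrm x y"
    by (simp add: norm_dist_def nonneg diff)
  show "norm_dist V nrm x y = norm_dist V nrm y x"
    by (simp add: norm_dist_def minus)
  show "norm_dist V nrm x y = 0 \<longleftrightarrow> x = y" if "x \<in> V" "y \<in> V"
    using zero[OF diff[OF that]] that by (simp only: norm_dist_def simp_thms if_True right_minus_eq)
  show "norm_dist V nrm x z \<le> norm_dist V nrm x y + norm_dist V nrm y z"
    if "x \<in> V" "y \<in> V" "z \<in> V"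
    using triangle[OF diff[OF that(1,2)] diff[OF that(2,3)]] that
    by (simp only: norm_dist_def simp_thms if_True diff_add_cancel add_diff_eq)
qed

lemma norm_dist_UNIV: "norm_dist UNIV (norm :: 'a::real_normed_vector \<Rightarrow> real) = dist"
  by (auto simp: norm_dist_def dist_norm fun_eq_iff)

lemma norm_topology_UNIV:
  "norm_topology UNIV (norm :: 'a::real_normed_vector \<Rightarrow> real) = euclidean"
  by (simp add: norm_topology_def norm_dist_UNIV)

lemma banach_on_UNIV: "banach_on UNIV (norm :: 'a::banach \<Rightarrow> real)"
  by (auto simp: banach_on_def norm_on_def norm_dist_UNIV norm_triangle_ineq complete_UNIV)

lemma onorm_on_UNIV: "onorm_on UNIV norm = onorm"
  by (simp add: onorm_on_def onorm_def fun_eq_iff)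

section \<open>The spaces \<open>\<ell>\<^sub>p\<close>\<close>

definition lp :: "real \<Rightarrow> (nat \<Rightarrow> real) set" where
  "lp p = {x. summable (\<lambda>n. \<bar>x n\<bar> powr p)}"

definition lp_norm :: "real \<Rightarrow> (nat \<Rightarrow> real) \<Rightarrow> real" where
  "lp_norm p x = (\<Sum>n. \<bar>x n\<bar> powr p) powr (1 / p)"

section \<open>Filters, bases and admissible sequences\<close>

text \<open>A set \<open>A\<close> belongs to the filter \<open>F\<close> iff \<open>eventually (\<lambda>n. n \<in> A) F\<close>. The library type
  of filters includes the improper filter \<^const>\<open>bot\<close>, which contains the empty set and has
  to be excluded. The index set \<open>{1, 2, \<dots>}\<close> is renumbered as \<open>{0, 1, \<dots>}\<close>, so the \<open>n\<close>-th
  partial sum, counted from 0, has the \<open>n + 1\<close> terms with index \<open>k \<le> n\<close>.\<close>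

definition free_filter :: "nat filter \<Rightarrow> bool" where
  "free_filter F \<longleftrightarrow> F \<noteq> bot \<and> (\<forall>A. finite (- A) \<longrightarrow> eventually (\<lambda>n. n \<in> A) F)"

definition stationary :: "nat filter \<Rightarrow> nat set \<Rightarrow> bool" where
  "stationary F I \<longleftrightarrow> (\<forall>A. eventually (\<lambda>n. n \<in> A) F \<longrightarrow> I \<inter> A \<noteq> {})"

definition admissible :: "nat filter \<Rightarrow> real \<Rightarrow> (nat \<Rightarrow> real) \<Rightarrow> bool" where
  "admissible F q a \<longleftrightarrow> (\<forall>n. 0 < a n) \<and>
     (\<forall>I. stationary F I \<longrightarrow> (\<Sum>\<^sub>\<infinity>n\<in>I. ennreal (a n powr (- q))) = \<infinity>)"

definition expands ::
  "nat filter \<Rightarrow> 'a::real_vector set \<Rightarrow> ('a \<Rightarrow> real) \<Rightarrow> (nat \<Rightarrow> 'a) \<Rightarrow> 'a \<Rightarrow> (nat \<Rightarrow> real) \<Rightarrow> bool" where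
  "expands F V nrm u x c \<longleftrightarrow>
     limitin (norm_topology V nrm) (\<lambda>n. \<Sum>k\<le>n. c k *\<^sub>R u k) x F"

definition filter_basis ::
  "nat filter \<Rightarrow> 'a::real_vector set \<Rightarrow> ('a \<Rightarrow> real) \<Rightarrow> (nat \<Rightarrow> 'a) \<Rightarrow> bool" where
  "filter_basis F V nrm u \<longleftrightarrow> range u \<subseteq> V \<and> (\<forall>x\<in>V. \<exists>!c. expands F V nrm u x c)"

definition coord ::
  "nat filter \<Rightarrow> 'a::real_vector set \<Rightarrow> ('a \<Rightarrow> real) \<Rightarrow> (nat \<Rightarrow> 'a) \<Rightarrow> nat \<Rightarrow> 'a \<Rightarrow> real" where
  "coord F V nrm u k x = (THE c. expands F V nrm u x c) k"

definition continuous_coords ::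
  "nat filter \<Rightarrow> 'a::real_vector set \<Rightarrow> ('a \<Rightarrow> real) \<Rightarrow> (nat \<Rightarrow> 'a) \<Rightarrow> bool" where
  "continuous_coords F V nrm u \<longleftrightarrow>
     (\<forall>k. continuous_map (norm_topology V nrm) euclideanreal (coord F V nrm u k))"

definition partial_sum ::
  "nat filter \<Rightarrow> 'a::real_vector set \<Rightarrow> ('a \<Rightarrow> real) \<Rightarrow> (nat \<Rightarrow> 'a) \<Rightarrow> nat \<Rightarrow> 'a \<Rightarrow> 'a" where
  "partial_sum F V nrm u n x = (\<Sum>k\<le>n. coord F V nrm u k x *\<^sub>R u k)"

end

theory Submission
  imports Defs
begin

text \<open>Call a norm \<open>q\<close>-smooth (\<open>smooth_on\<close>) if \<open>\<parallel>x + y\<parallel>\<^sup>q + \<parallel>x -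
y\<parallel>\<^sup>q \<le> 2 \<parallel>x\<parallel>\<^sup>q + 2 \<parallel>y\<parallel>\<^sup>q\<close>. Every norm is 1-smooth by the triangle
inequality, and the norm of \<open>\<ell>\<^sub>p\<close> is \<open>p\<close>-smooth for \<open>1 \<le> p \<le> 2\<close>. All three parts follow from
one statement, \<open>smooth_imp_admissible\<close>: in a \<open>q\<close>-smooth Banach space the norms of the partial sum operators form an
\<open>(F, q)\<close>-admissible sequence. For \<open>\<ell>\<^sub>p\<close> with \<open>1 < p < 2\<close> this gives even \<open>s = p\<close>, and
smaller exponents follow since \<open>\<parallel>S\<^sub>n\<parallel> \<ge> 1\<close>.

Suppose that \<open>I\<close> is stationary and \<open>\<Sum>\<^bsub>n \<in> I\<^esub> \<parallel>S\<^sub>n\<parallel>\<^sup>-\<^sup>q\<close> is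
finite. By Hahn-Banach in the finite-dimensional range of \<open>S\<^sub>n\<close> there are functionals \<open>f\<^sub>n\<close> with
\<open>\<bar>f\<^sub>n x\<bar> \<le> \<parallel>S\<^sub>n x\<parallel>\<close> and vectors \<open>y\<^sub>n\<close> with \<open>f\<^sub>n y\<^sub>n =
1\<close> and \<open>\<parallel>y\<^sub>n\<parallel> \<le> 2 / \<parallel>S\<^sub>n\<parallel>\<close>. It is enough to find finitely many vectors
\<open>z\<^sub>b\<close> of norm at most 1/64 such that for every \<open>n\<close> in a stationary part of \<open>I\<close> one of the
\<open>\<bar>f\<^sub>n z\<^sub>b\<bar>\<close> is at least 1/32: then \<open>S\<^sub>n z\<^sub>b\<close> stays away from \<open>z\<^sub>b\<close> for
one of the finitely many \<open>b\<close>, for each such \<open>n\<close>, although \<open>S\<^sub>n z\<^sub>b\<close> is \<open>F\<close>-convergent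
to \<open>z\<^sub>b\<close> for every \<open>b\<close>.

Finding the vectors is a plank problem in the spirit of Bang and Ball. That several vectors are allowed makes potential theory available: the values
\<open>(f\<^sub>n z\<^sub>b)\<^sub>b\<close> form a point of a Euclidean space, here of dimension 16, and on that space \<open>1 / (1 +
\<bar>v\<bar>\<^sup>2)\<close> is bounded and superharmonic. For finitely many indices (\<open>finite_planks\<close>) almost minimize
\<open>\<Sum>\<^sub>n \<parallel>y\<^sub>n\<parallel>\<^sup>q / (1 + \<bar>f\<^sub>n z\<bar>\<^sup>2) + \<kappa> \<Sum>\<^sub>b
\<parallel>z\<^sub>b\<parallel>\<^sup>q\<close> with a small constant \<open>\<kappa>\<close>. If \<open>\<bar>f\<^sub>j z\<bar> < 1\<close> for some
\<open>j\<close>, then superharmonicity yields a unit vector \<open>p\<close> for which the two moves \<open>z\<^sub>b \<mapsto> z\<^sub>b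
\<plusminus> p\<^sub>b y\<^sub>j\<close> together decrease the first sum by at least a fixed multiple of
\<open>\<parallel>y\<^sub>j\<parallel>\<^sup>q\<close>, while by smoothness they increase the second term by no more than a small multiple of
\<open>\<parallel>y\<^sub>j\<parallel>\<^sup>q\<close>; one of them contradicts the choice of \<open>z\<close>. Since the function is bounded, the
same works when fixed offsets are added to the values \<open>f\<^sub>n z\<close>.

For infinitely many indices split \<open>I\<close> into consecutive finite blocks, so long that what remains after the next block is negligible for
all functionals up to the present one. One of the two halves of \<open>I\<close> that consist of every second block is stationary. Within such a half
the blocks are treated one after the other, with the contribution of the earlier ones as offset; the later corrections are too small to destroy what
has been achieved (\<open>block_planks\<close>).\<close>

section \<open>A bounded superharmonic function\<close>

definition bump :: "'b::real_normed_vector \<Rightarrow> real" where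
  "bump v = 1 / (1 + (norm v)\<^sup>2)"

lemma bump_pos: "0 < bump v"
  unfolding bump_def by (simp add: add_pos_nonneg)

lemma bump_le_1: "bump v \<le> 1"
  unfolding bump_def by (simp add: divide_le_eq_1 add_pos_nonneg)

lemma continuous_on_bump:
  assumes "continuous_on S f"
  shows "continuous_on S (\<lambda>x. bump (f x))"
  unfolding bump_def
proof (intro continuous_intros assms ballI)
  fix x show "1 + (norm (f x))\<^sup>2 \<noteq> 0"
    using zero_le_power2[of "norm (f x)"] by linarith
qed

text \<open>Second-order control of the two-point mean of \<open>1 / t\<close> around \<open>D\<close>, from \<open>1 / (1 - \<tau>) \<le> 1 + 2
\<tau>\<close> for \<open>\<tau> = x\<^sup>2 / D\<^sup>2 \<le> 1/2\<close>.\<close>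
lemma recip_pair_le:
  fixes D x :: real
  assumes D: "0 < D" and x: "2 * x\<^sup>2 \<le> D\<^sup>2"
  shows "1 / (D + x) + 1 / (D - x) \<le> 2 / D + 4 * x\<^sup>2 / D ^ 3"
proof -
  have "x\<^sup>2 < D\<^sup>2"
    using x zero_less_power[OF D, of 2] zero_le_power2[of x] by linarith
  then have abs: "\<bar>x\<bar> < D" using D by (simp add: abs_square_less_1 power2_less_imp_less)
  then have p: "0 < D + x" "0 < D - x" by auto
  have "1 / (D + x) + 1 / (D - x) = 2 * D / (D\<^sup>2 - x\<^sup>2)"
    using p by (simp add: field_simps power2_eq_square)
  also have "\<dots> \<le> 2 / D + 4 * x\<^sup>2 / D ^ 3"
  proof -
    have pos: "0 < D\<^sup>2 - x\<^sup>2" using \<open>x\<^sup>2 < D\<^sup>2\<close> by simp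
    have e: "2 / D + 4 * x\<^sup>2 / D ^ 3 = (2 * D\<^sup>2 + 4 * x\<^sup>2) / D ^ 3"
      using D by (simp add: field_simps power2_eq_square power3_eq_cube)
    have "2 * D * D ^ 3 \<le> (2 * D\<^sup>2 + 4 * x\<^sup>2) * (D\<^sup>2 - x\<^sup>2)"
    proof -
      have "(2 * D\<^sup>2 + 4 * x\<^sup>2) * (D\<^sup>2 - x\<^sup>2) - 2 * D * D ^ 3 = 2 * x\<^sup>2 * (D\<^sup>2 - 2 * x\<^sup>2)"
        by (simp add: algebra_simps power2_eq_square power3_eq_cube)
      moreover have "0 \<le> 2 * x\<^sup>2 * (D\<^sup>2 - 2 * x\<^sup>2)"
        using x by (intro mult_nonneg_nonneg) auto
      ultimately show ?thesis by linarith
    qed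
    then show ?thesis
      unfolding e using D pos by (simp add: divide_le_eq pos_le_divide_eq field_simps)
  qed
  finally show ?thesis .
qed

text \<open>A discrete form of superharmonicity: the mean of \<open>bump\<close> over the points \<open>v \<plusminus> a b\<close> falls below
\<open>bump v\<close>. Only the steps \<open>a\<close> have to be small, uniformly in \<open>v\<close>. Moving along \<open>b\<close> changes \<open>1
+ \<bar>v\<bar>\<^sup>2\<close> to \<open>D \<plusminus> 2 a (v \<bullet> b)\<close>; the linear terms cancel in pairs, and the squares of the
\<open>v \<bullet> b\<close> sum up to \<open>\<bar>v\<bar>\<^sup>2\<close>, which is outweighed by the gain \<open>a\<^sup>2\<close> that each of the
\<open>DIM('b)\<close> directions contributes to \<open>D\<close>. Dimension 9 is the first for which this crude count gives a strict
decrease.\<close>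
lemma bump_superharmonic:
  fixes v :: "'b::euclidean_space" and a :: real
  assumes a: "a\<^sup>2 \<le> 1/8"
  shows "(\<Sum>b\<in>Basis. bump (v + a *\<^sub>R b) + bump (v - a *\<^sub>R b))
    \<le> 2 * DIM('b) * bump v - 2 * (real DIM('b) - 8) * a\<^sup>2 / ((1 + (norm v)\<^sup>2) * (1 + (norm v)\<^sup>2 + a\<^sup>2))"
proof -
  define B where "B = 1 + (norm v)\<^sup>2"
  define D where "D = B + a\<^sup>2"
  have B: "1 \<le> B" unfolding B_def by simp
  have D: "0 < D" "1 \<le> D" "B \<le> D" using B unfolding D_def by (auto simp: add_pos_nonneg add_increasing2)
  have sq: "(\<Sum>b\<in>Basis. (v \<bullet> b)\<^sup>2) = B - 1"
    unfolding B_def by (simp only: power2_norm_eq_inner euclidean_inner[of v v]) (simp add: power2_eq_square)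
  have n: "1 + (norm (v + a *\<^sub>R b))\<^sup>2 = D + 2 * a * (v \<bullet> b)"
          "1 + (norm (v - a *\<^sub>R b))\<^sup>2 = D - 2 * a * (v \<bullet> b)" if "b \<in> Basis" for b
    using that unfolding D_def B_def power2_norm_eq_inner
    by (simp_all add: inner_add_left inner_add_right inner_diff_left inner_diff_right
        inner_commute inner_same_Basis power2_eq_square algebra_simps)
  have t: "bump (v + a *\<^sub>R b) + bump (v - a *\<^sub>R b) \<le> 2 / D + 16 * a\<^sup>2 / D ^ 3 * (v \<bullet> b)\<^sup>2"
    if b: "b \<in> Basis" for b
  proof -
    have "(v \<bullet> b)\<^sup>2 \<le> (norm v)\<^sup>2"
      using Basis_le_norm[OF b, of v] by (metis abs_ge_zero power2_abs power_mono)
    then have "(v \<bullet> b)\<^sup>2 \<le> D" using D(3) unfolding B_def by linarith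
    also have "\<dots> \<le> D\<^sup>2" using D(2) by (simp add: power2_eq_square)
    finally have "a\<^sup>2 * (v \<bullet> b)\<^sup>2 \<le> (1/8) * D\<^sup>2" by (intro mult_mono a) auto
    then have "2 * (2 * a * (v \<bullet> b))\<^sup>2 \<le> D\<^sup>2" by (simp add: power_mult_distrib)
    from recip_pair_le[OF D(1) this] show ?thesis
      unfolding bump_def n[OF b] by (simp add: power_mult_distrib)
  qed
  have "(\<Sum>b\<in>Basis. bump (v + a *\<^sub>R b) + bump (v - a *\<^sub>R b))
      \<le> (\<Sum>b\<in>(Basis::'b set). 2 / D + 16 * a\<^sup>2 / D ^ 3 * (v \<bullet> b)\<^sup>2)"
    by (intro sum_mono t)
  also have "\<dots> = DIM('b) * (2 / D) + 16 * a\<^sup>2 / D ^ 3 * (B - 1)"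
    by (simp only: sum.distrib sum_distrib_left[symmetric] sq) simp
  also have "\<dots> \<le> DIM('b) * (2 / D) + 16 * a\<^sup>2 / (B * D)"
  proof -
    have "B * (B - 1) \<le> D\<^sup>2" using D(3) B by (simp add: power2_eq_square mult_mono)
    then have "B * (B - 1) * D \<le> D\<^sup>2 * D" using D(1) by (intro mult_right_mono) auto
    then have "(B - 1) / D ^ 3 \<le> 1 / (B * D)"
      using B D(1) by (simp add: field_simps power2_eq_square power3_eq_cube)
    then have "16 * a\<^sup>2 * ((B - 1) / D ^ 3) \<le> 16 * a\<^sup>2 * (1 / (B * D))"
      by (intro mult_left_mono) auto
    then show ?thesis by simp
  qed
  also have "\<dots> = 2 * DIM('b) * (1 / B) - 2 * (real DIM('b) - 8) * a\<^sup>2 / (B * D)"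
  proof -
    have "1 / D = 1 / B - a\<^sup>2 / (B * D)"
      using B D(1) by (simp add: field_simps) (simp add: D_def)
    then have "2 / D = 2 * (1 / B) - 2 * (a\<^sup>2 / (B * D))" by linarith
    then show ?thesis by (simp add: left_diff_distrib right_diff_distrib add_divide_distrib diff_divide_distrib mult.assoc mult.left_commute mult.commute[of 2])
  qed
  finally show ?thesis
    unfolding bump_def B_def D_def by simp
qed

text \<open>Any fixed dimension above 8 would do; with 16 there is room for simple constants.\<close>
type_synonym R16 = "real^16"

text \<open>The minimum principle for superharmonic functions, with a quantitative gain: the sum is superharmonic in \<open>p\<close>, and strictly so
because of its \<open>j\<close>-th term, which near the origin is strictly superharmonic. In the unit ball it stays so after adding a small multiple
\<open>c j / 100\<close> of \<open>\<bar>p\<bar>\<^sup>2\<close>, so the minimum over the closed unit ball lies on the sphere, where the added term is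
\<open>c j / 100\<close>. The coefficients \<open>a i\<close> may be arbitrarily large. The step \<open>t\<close> is adapted to them, which is
harmless, since the contradiction at an interior minimum does not depend on the size of \<open>t\<close>.\<close>
lemma bump_descent:
  fixes v :: "'i \<Rightarrow> R16" and a c :: "'i \<Rightarrow> real"
  assumes A: "finite A" and c: "\<And>i. i \<in> A \<Longrightarrow> 0 \<le> c i"
    and j: "j \<in> A" "0 < c j" "\<bar>a j\<bar> = 1" "norm (v j) \<le> 1"
  shows "\<exists>p. norm p = 1 \<and>
    (\<Sum>i\<in>A. c i * bump (v i + a i *\<^sub>R p)) \<le> (\<Sum>i\<in>A. c i * bump (v i)) - c j / 100"
proof -
  define h where "h p = (\<Sum>i\<in>A. c i * bump (v i + a i *\<^sub>R p))" for p
  define \<delta> where "\<delta> = c j / 100"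
  define g where "g p = h p + \<delta> * (norm p)\<^sup>2" for p
  have \<delta>: "0 \<le> \<delta>" unfolding \<delta>_def using c[OF j(1)] by simp
  have "continuous_on (cball 0 1) g"
    unfolding g_def h_def by (intro continuous_intros continuous_on_bump)
  then obtain p where p: "norm p \<le> 1" and min: "\<And>r. norm r \<le> 1 \<Longrightarrow> g p \<le> g r"
    using continuous_attains_inf[of "cball (0::R16) 1" g] by (auto simp: dist_norm)
  have "g p \<le> g 0" by (rule min) simp
  then have gp: "h p + \<delta> * (norm p)\<^sup>2 \<le> (\<Sum>i\<in>A. c i * bump (v i))"
    unfolding g_def h_def by simp
  have *: "norm p = 1"
  proof (rule ccontr)
    assume "norm p \<noteq> 1"
    then have p1: "norm p < 1" using p by simp
    define M where "M = (\<Sum>i\<in>A. \<bar>a i\<bar>)"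
    have M: "\<bar>a i\<bar> \<le> M" if "i \<in> A" for i
      unfolding M_def using A that by (intro member_le_sum) auto
    have M1: "1 \<le> M" using M[OF j(1)] j(3) by simp
    \<comment> \<open>Small enough for \<open>p \<plusminus> t b\<close> to stay in the ball and for \<open>bump_superharmonic\<close> to apply to all steps \<open>t * a i\<close>.\<close>
    define t where "t = min (1 - norm p) (1 / (3 * M))"
    have t: "0 < t" "t \<le> 1 - norm p" "t * M \<le> 1/3"
      using p1 M1 unfolding t_def by (auto simp: min_def field_simps)
    have t1: "t \<le> 1/3"
    proof -
      have "t * 1 \<le> t * M" using M1 t(1) by (intro mult_left_mono) auto
      then show ?thesis using t(3) by simp
    qed
    have small: "(t * a i)\<^sup>2 \<le> 1/8" if "i \<in> A" for i
    proof -
      have "\<bar>t * a i\<bar> \<le> t * M" using M[OF that] t(1) by (simp add: abs_mult)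
      also have "\<dots> \<le> 1/3" by (rule t(3))
      finally have "\<bar>t * a i\<bar>\<^sup>2 \<le> (1/3)\<^sup>2" by (intro power_mono) auto
      then show ?thesis by (simp add: power2_eq_square)
    qed
    define B where "B i = 1 + (norm (v i + a i *\<^sub>R p))\<^sup>2" for i
    have B1: "1 \<le> B i" for i unfolding B_def by simp
    have step: "(\<Sum>b\<in>Basis. bump (v i + a i *\<^sub>R (p + t *\<^sub>R b)) + bump (v i + a i *\<^sub>R (p - t *\<^sub>R b)))
      \<le> 32 * bump (v i + a i *\<^sub>R p) - 16 * (t * a i)\<^sup>2 / (B i * (B i + (t * a i)\<^sup>2))"
      if "i \<in> A" for i
    proof -
      have e: "v i + a i *\<^sub>R (p + t *\<^sub>R b) = (v i + a i *\<^sub>R p) + (t * a i) *\<^sub>R b"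
        "v i + a i *\<^sub>R (p - t *\<^sub>R b) = (v i + a i *\<^sub>R p) - (t * a i) *\<^sub>R b" for b
        by (simp_all add: algebra_simps)
      show ?thesis
        using bump_superharmonic[OF small[OF that], of "v i + a i *\<^sub>R p"]
        unfolding e B_def by simp
    qed
    have hsum: "(\<Sum>b\<in>Basis. h (p + t *\<^sub>R b) + h (p - t *\<^sub>R b)) \<le> 32 * h p - c j * (16 * t\<^sup>2 / 30)"
    proof -
      have "(\<Sum>b\<in>Basis. h (p + t *\<^sub>R b) + h (p - t *\<^sub>R b)) =
        (\<Sum>i\<in>A. c i * (\<Sum>b\<in>Basis. bump (v i + a i *\<^sub>R (p + t *\<^sub>R b)) + bump (v i + a i *\<^sub>R (p - t *\<^sub>R b))))"
        unfolding h_def sum.distrib[symmetric] distrib_left[symmetric]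
        by (subst sum.swap) (simp add: sum_distrib_left)
      also have "\<dots> \<le> (\<Sum>i\<in>A. c i * (32 * bump (v i + a i *\<^sub>R p) - 16 * (t * a i)\<^sup>2 / (B i * (B i + (t * a i)\<^sup>2))))"
        by (intro sum_mono mult_left_mono step c)
      also have "\<dots> = 32 * h p - (\<Sum>i\<in>A. c i * (16 * (t * a i)\<^sup>2 / (B i * (B i + (t * a i)\<^sup>2))))"
        unfolding h_def by (simp add: right_diff_distrib sum_subtractf sum_distrib_left mult.left_commute)
      also have "\<dots> \<le> 32 * h p - c j * (16 * (t * a j)\<^sup>2 / (B j * (B j + (t * a j)\<^sup>2)))"
      proof -
        have "c j * (16 * (t * a j)\<^sup>2 / (B j * (B j + (t * a j)\<^sup>2)))
          \<le> (\<Sum>i\<in>A. c i * (16 * (t * a i)\<^sup>2 / (B i * (B i + (t * a i)\<^sup>2))))"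
        proof (rule member_le_sum[OF j(1) _ A])
          fix i assume "i \<in> A - {j}"
          then show "0 \<le> c i * (16 * (t * a i)\<^sup>2 / (B i * (B i + (t * a i)\<^sup>2)))"
            using c[of i] B1[of i] by (intro mult_nonneg_nonneg divide_nonneg_nonneg) auto
        qed
        then show ?thesis by linarith
      qed
      also have "\<dots> \<le> 32 * h p - c j * (16 * t\<^sup>2 / 30)"
      proof -
        have "norm (v j + a j *\<^sub>R p) \<le> 2"
          using norm_triangle_ineq[of "v j" "a j *\<^sub>R p"] j p by simp
        then have "(norm (v j + a j *\<^sub>R p))\<^sup>2 \<le> 2\<^sup>2" by (intro power_mono) auto
        then have Bj: "B j \<le> 5" unfolding B_def by simp
        have tj: "(t * a j)\<^sup>2 = t\<^sup>2"
          using j(3) by (metis mult.right_neutral power2_abs power_mult_distrib power_one)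
        have "t\<^sup>2 \<le> 1" using t1 t(1) by (simp add: power_le_one)
        then have "B j * (B j + t\<^sup>2) \<le> 5 * 6" using Bj B1[of j] by (intro mult_mono) auto
        then have "16 * t\<^sup>2 / 30 \<le> 16 * t\<^sup>2 / (B j * (B j + t\<^sup>2))"
          using B1[of j] by (intro divide_left_mono mult_pos_pos add_pos_nonneg) auto
        then show ?thesis unfolding tj using j(2) by (intro diff_left_mono mult_left_mono) auto
      qed
      finally show ?thesis .
    qed
    have nsum: "(\<Sum>b\<in>Basis. (norm (p + t *\<^sub>R b))\<^sup>2 + (norm (p - t *\<^sub>R b))\<^sup>2) = 32 * (norm p)\<^sup>2 + 32 * t\<^sup>2"
    proof -
      have "(norm (p + t *\<^sub>R b))\<^sup>2 + (norm (p - t *\<^sub>R b))\<^sup>2 = 2 * (norm p)\<^sup>2 + 2 * t\<^sup>2" if "b \<in> Basis" for b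
        using that unfolding power2_norm_eq_inner by (simp add: inner_add_left inner_add_right inner_diff_left
            inner_diff_right inner_commute inner_same_Basis power2_eq_square algebra_simps)
      then show ?thesis by simp
    qed
    have "32 * g p = (\<Sum>b\<in>(Basis::R16 set). g p + g p)" by simp
    also have "\<dots> \<le> (\<Sum>b\<in>Basis. g (p + t *\<^sub>R b) + g (p - t *\<^sub>R b))"
    proof (intro sum_mono add_mono min)
      fix b :: R16 assume b: "b \<in> Basis"
      show "norm (p + t *\<^sub>R b) \<le> 1" using norm_triangle_ineq[of p "t *\<^sub>R b"] b t by simp
      show "norm (p - t *\<^sub>R b) \<le> 1" using norm_triangle_ineq4[of p "t *\<^sub>R b"] b t by simp
    qed
    also have "\<dots> = (\<Sum>b\<in>Basis. h (p + t *\<^sub>R b) + h (p - t *\<^sub>R b))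
        + \<delta> * (\<Sum>b\<in>Basis. (norm (p + t *\<^sub>R b))\<^sup>2 + (norm (p - t *\<^sub>R b))\<^sup>2)"
      unfolding g_def by (simp add: sum.distrib sum_distrib_left algebra_simps)
    also have "\<dots> \<le> 32 * g p - c j * (16 * t\<^sup>2 / 30) + \<delta> * (32 * t\<^sup>2)"
      using hsum unfolding nsum g_def by (simp add: algebra_simps)
    finally have "c j * (16 * t\<^sup>2 / 30) \<le> \<delta> * (32 * t\<^sup>2)" by simp
    \<comment> \<open>The 32 points gain \<open>16/30\<close> from the \<open>j\<close>-th term, as \<open>B j \<le> 5\<close>, and lose \<open>32/100\<close> to the added term.\<close>
    then have "(c j * t\<^sup>2) * (16/30) \<le> (c j * t\<^sup>2) * (32/100)" unfolding \<delta>_def by simp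
    moreover have "0 < c j * t\<^sup>2" using j(2) t(1) by simp
    ultimately show False by simp
  qed
  show ?thesis
    using * gp unfolding h_def \<delta>_def by (intro exI[of _ p]) simp
qed

section \<open>Planks for finitely many functionals\<close>

text \<open>Linearity is asked for on the carrier only: coordinate functionals of a basis have arbitrary values elsewhere.\<close>
definition functional_on :: "'a::real_vector set \<Rightarrow> ('a \<Rightarrow> real) \<Rightarrow> bool" where
  "functional_on V f \<longleftrightarrow>
     (\<forall>x\<in>V. \<forall>y\<in>V. f (x + y) = f x + f y) \<and> (\<forall>x\<in>V. \<forall>a. f (a *\<^sub>R x) = a * f x)"

text \<open>A family of 16 vectors, indexed by the standard basis of \<open>R16\<close>, is mapped by one functional to a point of
\<open>R16\<close>.\<close>
definition spread :: "('a \<Rightarrow> real) \<Rightarrow> (R16 \<Rightarrow> 'a) \<Rightarrow> R16" where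
  "spread f z = (\<Sum>b\<in>Basis. f (z b) *\<^sub>R b)"

lemma spread_nth: "b \<in> Basis \<Longrightarrow> spread f z \<bullet> b = f (z b)"
  unfolding spread_def by simp

lemma spread_perturb:
  assumes f: "functional_on V f" and z: "\<And>b. b \<in> Basis \<Longrightarrow> z b \<in> V" and y: "y \<in> V" and V: "subspace V"
  shows "spread f (\<lambda>b. z b + (p \<bullet> b) *\<^sub>R y) = spread f z + f y *\<^sub>R p"
proof (rule euclidean_eqI)
  fix b :: R16 assume b: "b \<in> Basis"
  have "f (z b + (p \<bullet> b) *\<^sub>R y) = f (z b) + f ((p \<bullet> b) *\<^sub>R y)"
    using f z[OF b] subspace_scale[OF V y] unfolding functional_on_def by blast
  then show "spread f (\<lambda>b. z b + (p \<bullet> b) *\<^sub>R y) \<bullet> b = (spread f z + f y *\<^sub>R p) \<bullet> b"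
    using f y b by (simp add: spread_nth inner_add_left functional_on_def)
qed

locale normed_carrier =
  fixes V :: "'a::real_vector set" and nrm :: "'a \<Rightarrow> real"
  assumes V: "subspace V" and N: "norm_on V nrm"
begin

lemma zero_V: "0 \<in> V" by (rule subspace_0[OF V])
lemma add_V: "x \<in> V \<Longrightarrow> y \<in> V \<Longrightarrow> x + y \<in> V" by (rule subspace_add[OF V])
lemma scale_V: "x \<in> V \<Longrightarrow> a *\<^sub>R x \<in> V" by (rule subspace_scale[OF V])
lemma diff_V: "x \<in> V \<Longrightarrow> y \<in> V \<Longrightarrow> x - y \<in> V" by (rule subspace_diff[OF V])
lemma sum_V: "(\<And>i. i \<in> A \<Longrightarrow> f i \<in> V) \<Longrightarrow> (\<Sum>i\<in>A. f i) \<in> V" by (rule subspace_sum[OF V])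

lemma nrm_nonneg: "x \<in> V \<Longrightarrow> 0 \<le> nrm x"
  by (rule N[unfolded norm_on_def, THEN conjunct1, rule_format])
lemma nrm_eq_0: "x \<in> V \<Longrightarrow> nrm x = 0 \<longleftrightarrow> x = 0"
  by (rule N[unfolded norm_on_def, THEN conjunct2, THEN conjunct1, rule_format])
lemma nrm_scale: "x \<in> V \<Longrightarrow> nrm (a *\<^sub>R x) = \<bar>a\<bar> * nrm x"
  by (rule N[unfolded norm_on_def, THEN conjunct2, THEN conjunct2, THEN conjunct1, rule_format])
lemma nrm_add: "x \<in> V \<Longrightarrow> y \<in> V \<Longrightarrow> nrm (x + y) \<le> nrm x + nrm y"
  by (rule N[unfolded norm_on_def, THEN conjunct2, THEN conjunct2, THEN conjunct2, rule_format])
lemma nrm_0: "nrm 0 = 0" using nrm_eq_0[OF zero_V] by simp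
lemma nrm_pos: "x \<in> V \<Longrightarrow> x \<noteq> 0 \<Longrightarrow> 0 < nrm x"
  using nrm_nonneg[of x] nrm_eq_0[of x] by linarith
lemma nrm_minus: "x \<in> V \<Longrightarrow> nrm (- x) = nrm x"
  using nrm_scale[of x "-1"] by simp
lemma nrm_diff: "x \<in> V \<Longrightarrow> y \<in> V \<Longrightarrow> nrm (x - y) \<le> nrm x + nrm y"
  using nrm_add[of x "- y"] subspace_neg[OF V, of y] nrm_minus[of y] by simp
lemma nrm_sum: "finite A \<Longrightarrow> (\<And>i. i \<in> A \<Longrightarrow> f i \<in> V) \<Longrightarrow> nrm (\<Sum>i\<in>A. f i) \<le> (\<Sum>i\<in>A. nrm (f i))"
proof (induction A rule: finite_induct)
  case empty
  then show ?case by (simp add: nrm_0)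
next
  case (insert a A)
  have "nrm (f a + sum f A) \<le> nrm (f a) + nrm (sum f A)"
    using insert.prems by (intro nrm_add sum_V) auto
  moreover have "nrm (sum f A) \<le> (\<Sum>i\<in>A. nrm (f i))" using insert.IH insert.prems by simp
  ultimately show ?case using insert.hyps by simp
qed

end

text \<open>In \<open>finite_planks\<close> the 16 vectors are moved by multiples of one vector in two opposite directions; this inequality bounds the
mean cost of the two moves.\<close>
definition smooth_on :: "'a::real_vector set \<Rightarrow> ('a \<Rightarrow> real) \<Rightarrow> real \<Rightarrow> bool" where
  "smooth_on V nrm q \<longleftrightarrow> (\<forall>x\<in>V. \<forall>y\<in>V.
     nrm (x + y) powr q + nrm (x - y) powr q \<le> 2 * nrm x powr q + 2 * nrm y powr q)"

lemma (in normed_carrier) smooth_on_1: "smooth_on V nrm 1"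
  unfolding smooth_on_def
proof (intro ballI)
  fix x y assume "x \<in> V" "y \<in> V"
  then show "nrm (x + y) powr 1 + nrm (x - y) powr 1 \<le> 2 * nrm x powr 1 + 2 * nrm y powr 1"
    using nrm_add[of x y] nrm_diff[of x y] nrm_nonneg[of "x + y"] nrm_nonneg[of "x - y"]
      nrm_nonneg[of x] nrm_nonneg[of y] add_V[of x y] diff_V[of x y] by simp
qed

text \<open>The weight \<open>\<parallel>y i\<parallel>\<^sup>q\<close> of the \<open>i\<close>-th plank in the functional \<open>G\<close> is also,
up to a constant, the price of moving along \<open>y i\<close>, a direction in which the value of \<open>f i\<close> changes at rate 1. An almost
minimizer \<open>z\<close> of \<open>G\<close> therefore cannot leave a value \<open>w i + spread (f i) z\<close> in the open unit ball. Comparison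
with \<open>z = 0\<close> bounds its norm; this is where boundedness of \<open>bump\<close> enters, and why the offsets \<open>w i\<close> do not
matter.\<close>
lemma (in normed_carrier) finite_planks:
  fixes w :: "'i \<Rightarrow> R16"
  assumes q: "0 < q" and smooth: "smooth_on V nrm q" and J: "finite J"
    and f: "\<And>i. i \<in> J \<Longrightarrow> functional_on V (f i)"
    and y: "\<And>i. i \<in> J \<Longrightarrow> y i \<in> V" "\<And>i. i \<in> J \<Longrightarrow> f i (y i) = 1"
  shows "\<exists>z. (\<forall>b\<in>Basis. z b \<in> V) \<and>
    (\<Sum>b\<in>Basis. nrm (z b) powr q) \<le> 12800 * (\<Sum>i\<in>J. nrm (y i) powr q) \<and>
    (\<forall>i\<in>J. 1 \<le> norm (w i + spread (f i) z))"
proof (cases "J = {}")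
  case True
  then show ?thesis using q by (intro exI[of _ "\<lambda>_. 0"]) (simp add: zero_V nrm_0)
next
  case False
  define c where "c i = nrm (y i) powr q" for i
  define Z where "Z = {z :: R16 \<Rightarrow> 'a. \<forall>b\<in>Basis. z b \<in> V}"
  define H where "H z = (\<Sum>i\<in>J. c i * bump (w i + spread (f i) z))" for z
  define C where "C z = (\<Sum>b\<in>Basis. nrm (z b) powr q)" for z :: "R16 \<Rightarrow> 'a"
  \<comment> \<open>A unit move costs at most \<open>32 c j\<close> over both directions and gains \<open>c j / 100\<close>; the factor \<open>1/6400\<close> keeps half of the gain.\<close>
  define G where "G z = H z + C z / 6400" for z
  have c: "0 < c i" if "i \<in> J" for i
  proof -
    have "y i \<noteq> 0"
    proof
      assume "y i = 0"
      then have "f i (y i) = 0 * f i (y i)"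
        using f[OF that] y(1)[OF that] unfolding functional_on_def by (metis scaleR_zero_left)
      then show False using y(2)[OF that] by simp
    qed
    then show ?thesis unfolding c_def using nrm_pos[OF y(1)[OF that]] by simp
  qed
  have H0: "0 \<le> H z" for z
    unfolding H_def by (intro sum_nonneg mult_nonneg_nonneg) (auto simp: c less_imp_le bump_pos)
  have C0: "0 \<le> C z" for z unfolding C_def by (intro sum_nonneg) auto
  define \<eta> where "\<eta> = Min (c ` J) / 400"
  have \<eta>: "0 < \<eta>" unfolding \<eta>_def using J False c by (simp add: Min_gr_iff)
  have \<eta>c: "\<eta> \<le> c i / 400" if "i \<in> J" for i
    unfolding \<eta>_def using J that by simp
  have zeroZ: "(\<lambda>_. 0) \<in> Z" unfolding Z_def by (simp add: zero_V)
  have bdd: "bdd_below (G ` Z)"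
    by (rule bdd_belowI[of _ 0]) (auto simp: G_def H0 C0)
  have lower: "Inf (G ` Z) \<le> G z" if "z \<in> Z" for z
    using that bdd by (intro cInf_lower) auto
  obtain z where z: "z \<in> Z" "G z < Inf (G ` Z) + \<eta>"
    using cInf_lessD[of "G ` Z" "Inf (G ` Z) + \<eta>"] \<eta> zeroZ by auto
  have zV: "z b \<in> V" if "b \<in> Basis" for b using z(1) that unfolding Z_def by blast
  have "Inf (G ` Z) \<le> (\<Sum>i\<in>J. c i)"
  proof -
    have "G (\<lambda>_. 0) \<le> (\<Sum>i\<in>J. c i)"
      unfolding G_def H_def C_def using q
      by (simp add: nrm_0) (intro sum_mono mult_left_le bump_le_1 less_imp_le[OF c])
    then show ?thesis using lower[OF zeroZ] by simp
  qed
  moreover have "\<eta> \<le> (\<Sum>i\<in>J. c i)"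
  proof -
    obtain i where i: "i \<in> J" using False by blast
    have "c i \<le> (\<Sum>i\<in>J. c i)" using i J c by (intro member_le_sum) (auto simp: less_imp_le)
    then show ?thesis using \<eta>c[OF i] c[OF i] by linarith
  qed
  ultimately have cost: "C z \<le> 12800 * (\<Sum>i\<in>J. c i)"
    using z(2) H0[of z] unfolding G_def by linarith
  have "1 \<le> norm (w j + spread (f j) z)" if j: "j \<in> J" for j
  proof (rule ccontr)
    assume small: "\<not> ?thesis"
    \<comment> \<open>The index set is doubled so that one direction \<open>p\<close> serves for the moves by \<open>p\<close> and \<open>- p\<close> together.\<close>
    define v where "v = (\<lambda>(i, s::real). w i + spread (f i) z)"
    define a where "a = (\<lambda>(i, s::real). s * f i (y j))"
    define c2 where "c2 = (\<lambda>(i, s::real). c i)"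
    have "\<exists>p. norm p = 1 \<and>
      (\<Sum>k\<in>J \<times> {1, -1}. c2 k * bump (v k + a k *\<^sub>R p)) \<le> (\<Sum>k\<in>J \<times> {1, -1}. c2 k * bump (v k)) - c2 (j, 1) / 100"
    proof (rule bump_descent)
      show "finite (J \<times> {1, - 1 :: real})" using J by simp
      show "0 \<le> c2 i" if "i \<in> J \<times> {1, -1}" for i
        using that c by (auto simp: c2_def less_imp_le)
      show "(j, 1) \<in> J \<times> {1, -1}" using j by simp
      show "0 < c2 (j, 1)" using c[OF j] by (simp add: c2_def)
      show "\<bar>a (j, 1)\<bar> = 1" using y(2)[OF j] by (simp add: a_def)
      show "norm (v (j, 1)) \<le> 1" using small by (simp add: v_def)
    qed
    then obtain p where p: "norm p = 1" and
      desc: "(\<Sum>k\<in>J \<times> {1, -1}. c2 k * bump (v k + a k *\<^sub>R p)) \<le> (\<Sum>k\<in>J \<times> {1, -1}. c2 k * bump (v k)) - c2 (j, 1) / 100"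
      by blast
    define zp where "zp s b = z b + ((s *\<^sub>R p) \<bullet> b) *\<^sub>R y j" for s :: real and b
    have zpZ: "zp s \<in> Z" for s
      unfolding Z_def zp_def using zV y(1)[OF j] by (auto intro!: add_V scale_V)
    have sp: "spread (f i) (zp s) = spread (f i) z + (s * f i (y j)) *\<^sub>R p" if "i \<in> J" for i s
      unfolding zp_def using spread_perturb[OF f[OF that] zV y(1)[OF j] V, where p = "s *\<^sub>R p"]
      by (simp add: mult.commute)
    have split: "(\<Sum>k\<in>J \<times> {1, -1::real}. g k) = (\<Sum>i\<in>J. g (i, 1)) + (\<Sum>i\<in>J. g (i, -1))" for g :: "'i \<times> real \<Rightarrow> real"
    proof -
      have "(\<Sum>k\<in>J \<times> {1, -1}. g k) = (\<Sum>i\<in>J. \<Sum>s\<in>{1, -1}. g (i, s))"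
        by (simp only: sum.cartesian_product split_def prod.collapse)
      then show ?thesis by (simp add: sum.distrib)
    qed
    have "H (zp 1) + H (zp (-1)) \<le> 2 * H z - c j / 100"
      using desc unfolding split c2_def v_def a_def H_def by (simp add: sp add.assoc add_diff_eq[symmetric])
    moreover have "C (zp 1) + C (zp (-1)) \<le> 2 * C z + 32 * c j"
    proof -
      have "nrm (zp 1 b) powr q + nrm (zp (-1) b) powr q \<le> 2 * nrm (z b) powr q + 2 * c j"
        if b: "b \<in> Basis" for b
      proof -
        have sV: "(p \<bullet> b) *\<^sub>R y j \<in> V" using y(1)[OF j] by (rule scale_V)
        have "nrm (z b + (p \<bullet> b) *\<^sub>R y j) powr q + nrm (z b - (p \<bullet> b) *\<^sub>R y j) powr q
           \<le> 2 * nrm (z b) powr q + 2 * nrm ((p \<bullet> b) *\<^sub>R y j) powr q"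
          using smooth zV[OF b] sV unfolding smooth_on_def by blast
        also have "nrm ((p \<bullet> b) *\<^sub>R y j) powr q \<le> c j"
          unfolding c_def nrm_scale[OF y(1)[OF j]] using Basis_le_norm[OF b, of p] p q
            nrm_nonneg[OF y(1)[OF j]]
          by (intro powr_mono2 mult_left_le_one_le) auto
        finally show ?thesis unfolding zp_def by simp
      qed
      then have "(\<Sum>b\<in>Basis. nrm (zp 1 b) powr q + nrm (zp (-1) b) powr q) \<le> (\<Sum>b\<in>(Basis::R16 set). 2 * nrm (z b) powr q + 2 * c j)"
        by (intro sum_mono) auto
      then show ?thesis unfolding C_def by (simp add: sum.distrib sum_distrib_left)
    qed
    ultimately have "G (zp 1) + G (zp (-1)) \<le> 2 * G z - c j / 200" unfolding G_def by (simp add: field_simps)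
    then show False using lower[OF zpZ[of 1]] lower[OF zpZ[of "-1"]] z(2) \<eta>c[OF j] by linarith
  qed
  then show ?thesis
    using zV cost unfolding C_def c_def by (intro exI[of _ z]) auto
qed

section \<open>Planks for infinitely many functionals\<close>

lemma (in normed_carrier) geometric_limit:
  assumes complete: "Metric_space.mcomplete V (norm_dist V nrm)"
    and x: "\<And>k. x k \<in> V" and step: "\<And>k. nrm (x (Suc k) - x k) \<le> e k" and e: "summable e"
  shows "\<exists>s\<in>V. \<forall>n. nrm (s - x n) \<le> (\<Sum>k. e (k + n))"
proof -
  interpret M: Metric_space V "norm_dist V nrm" by (rule Metric_space_norm_dist[OF V N])
  have e0: "0 \<le> e k" for k using nrm_nonneg[OF diff_V[OF x x], of "Suc k" k] step[of k] by linarith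
  have sumn: "summable (\<lambda>k. e (k + n))" for n using e by (simp add: summable_iff_shift)
  have part: "nrm (x (n + m) - x n) \<le> (\<Sum>k<m. e (k + n))" for n m
  proof (induction m)
    case 0
    then show ?case by (simp add: nrm_0)
  next
    case (Suc m)
    have "nrm ((x (Suc (n + m)) - x (n + m)) + (x (n + m) - x n)) \<le> e (n + m) + (\<Sum>k<m. e (k + n))"
      using nrm_add[OF diff_V[OF x x] diff_V[OF x x], of "Suc (n + m)" "n + m" "n + m" n]
        step[of "n + m"] Suc by linarith
    then show ?case by (simp add: add.commute)
  qed
  have tail: "nrm (x m - x n) \<le> (\<Sum>k. e (k + n))" if "n \<le> m" for n m
  proof -
    have "nrm (x (n + (m - n)) - x n) \<le> (\<Sum>k<m - n. e (k + n))" by (rule part)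
    also have "\<dots> \<le> (\<Sum>k. e (k + n))" by (intro sum_le_suminf sumn) (auto simp: e0)
    finally show ?thesis using that by simp
  qed
  have lim0: "(\<lambda>n. \<Sum>k. e (k + n)) \<longlonglongrightarrow> 0" by (rule suminf_exist_split2[OF e])
  have "M.MCauchy x"
    unfolding M.MCauchy_def
  proof (intro conjI allI impI)
    show "range x \<subseteq> V" using x by blast
    fix \<epsilon> :: real assume "0 < \<epsilon>"
    then obtain n0 where n0: "\<And>n. n \<ge> n0 \<Longrightarrow> \<bar>\<Sum>k. e (k + n)\<bar> < \<epsilon>"
      using LIMSEQ_D[OF lim0, of \<epsilon>] by auto
    have "norm_dist V nrm (x n) (x n') < \<epsilon>" if "n0 \<le> n" "n \<le> n'" for n n'
    proof -
      have "nrm (x n' - x n) < \<epsilon>" using tail[OF that(2)] n0[OF that(1)] by linarith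
      then show ?thesis using x M.commute[of "x n" "x n'"] by (simp add: norm_dist_def)
    qed
    then show "\<exists>n0. \<forall>n n'. n0 \<le> n \<longrightarrow> n0 \<le> n' \<longrightarrow> norm_dist V nrm (x n) (x n') < \<epsilon>"
      using M.commute by (metis nat_le_linear)
  qed
  then obtain s where s: "limitin M.mtopology x s sequentially"
    using complete unfolding M.mcomplete_def by blast
  then have sV: "s \<in> V" by (simp add: M.limit_metric_sequentially)
  have "nrm (s - x n) \<le> (\<Sum>k. e (k + n))" for n
  proof (rule field_le_epsilon)
    fix \<epsilon> :: real assume "0 < \<epsilon>"
    then obtain m0 where m0: "\<And>m. m \<ge> m0 \<Longrightarrow> norm_dist V nrm (x m) s < \<epsilon>"
      using s unfolding M.limit_metric_sequentially by blast
    define m where "m = max m0 n"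
    have "norm_dist V nrm s (x m) < \<epsilon>" using m0[of m] unfolding m_def M.commute[of s] by simp
    then have "nrm (s - x m) < \<epsilon>" using sV x by (simp add: norm_dist_def)
    moreover have "nrm (x m - x n) \<le> (\<Sum>k. e (k + n))" by (rule tail) (simp add: m_def)
    moreover have "nrm ((s - x m) + (x m - x n)) \<le> nrm (s - x m) + nrm (x m - x n)"
      using sV x by (intro nrm_add diff_V)
    ultimately show "nrm (s - x n) \<le> (\<Sum>k. e (k + n)) + \<epsilon>" by simp
  qed
  then show ?thesis using sV by blast
qed

lemma functional_on_diff:
  assumes "functional_on V f" "subspace V" "x \<in> V" "y \<in> V"
  shows "f (x - y) = f x - f y"
proof -
  have "f ((x - y) + y) = f (x - y) + f y"
    using assms subspace_diff[OF assms(2-4)] unfolding functional_on_def by blast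
  then show ?thesis by simp
qed

text \<open>The vectors are constructed as limits of a sequence whose \<open>k\<close>-th step settles the block \<open>A k\<close>, by
\<open>finite_planks\<close> with the values reached so far as offsets. The bound on \<open>K i * e l\<close> for \<open>k < l\<close> makes all later
steps together change the values \<open>f i\<close> with \<open>i \<in> A k\<close> by at most \<open>1/32\<close> in each of the 16 coordinates,
hence by at most \<open>1/2\<close> in norm.\<close>
lemma (in normed_carrier) block_planks:
  fixes A :: "nat \<Rightarrow> 'i set"
  assumes q: "0 < q" and smooth: "smooth_on V nrm q"
    and complete: "Metric_space.mcomplete V (norm_dist V nrm)"
    and A: "\<And>k. finite (A k)"
    and f: "\<And>k i. i \<in> A k \<Longrightarrow> functional_on V (f i)"
    and K: "\<And>k i x. i \<in> A k \<Longrightarrow> x \<in> V \<Longrightarrow> \<bar>f i x\<bar> \<le> K i * nrm x"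
    and y: "\<And>k i. i \<in> A k \<Longrightarrow> y i \<in> V" "\<And>k i. i \<in> A k \<Longrightarrow> f i (y i) = 1"
    and e: "\<And>k. 0 < e k" "\<And>k. e k \<le> \<rho> * (1/2) ^ Suc k"
    and small: "\<And>k. 12800 * (\<Sum>i\<in>A k. nrm (y i) powr q) \<le> e k powr q"
    and later: "\<And>k l i. k < l \<Longrightarrow> i \<in> A k \<Longrightarrow> K i * e l \<le> (1/32) * (1/2) ^ l"
  shows "\<exists>z. (\<forall>b\<in>Basis. z b \<in> V \<and> nrm (z b) \<le> \<rho>) \<and> (\<forall>k. \<forall>i\<in>A k. 1/2 \<le> norm (spread (f i) z))"
proof -
  define P where "P k x \<longleftrightarrow> (\<forall>b\<in>Basis. x b \<in> V) \<and> (k = 0 \<longrightarrow> x = (\<lambda>_. 0))" for k :: nat and x :: "R16 \<Rightarrow> 'a"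
  define Q where "Q k x x' \<longleftrightarrow> (\<forall>b\<in>Basis. nrm (x' b - x b) \<le> e k) \<and>
    (\<forall>i\<in>A k. 1 \<le> norm (spread (f i) x'))" for k and x x' :: "R16 \<Rightarrow> 'a"
  have "\<exists>x. \<forall>k. P k (x k) \<and> Q k (x k) (x (Suc k))"
  proof (rule dependent_nat_choice)
    show "\<exists>x. P 0 x" unfolding P_def by (simp add: zero_V)
    fix x :: "R16 \<Rightarrow> 'a" and k assume "P k x"
    then have xV: "x b \<in> V" if "b \<in> Basis" for b using that unfolding P_def by blast
    have "\<exists>z. (\<forall>b\<in>Basis. z b \<in> V) \<and>
      (\<Sum>b\<in>Basis. nrm (z b) powr q) \<le> 12800 * (\<Sum>i\<in>A k. nrm (y i) powr q) \<and>
      (\<forall>i\<in>A k. 1 \<le> norm (spread (f i) x + spread (f i) z))"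
      by (rule finite_planks[OF q smooth A]) (use f y in auto)
    then obtain z where z: "\<And>b. b \<in> Basis \<Longrightarrow> z b \<in> V"
      "(\<Sum>b\<in>Basis. nrm (z b) powr q) \<le> 12800 * (\<Sum>i\<in>A k. nrm (y i) powr q)"
      "\<And>i. i \<in> A k \<Longrightarrow> 1 \<le> norm (spread (f i) x + spread (f i) z)"
      by blast
    have "nrm (z b) \<le> e k" if b: "b \<in> Basis" for b
    proof -
      have "nrm (z b) powr q \<le> (\<Sum>b\<in>Basis. nrm (z b) powr q)"
        using b by (intro member_le_sum) auto
      then have "nrm (z b) powr q \<le> e k powr q" using z(2) small[of k] by linarith
      then show ?thesis using q e(1)[of k] powr_less_mono2[of q "e k" "nrm (z b)"] by linarith
    qed
    moreover have "spread (f i) (\<lambda>b. x b + z b) = spread (f i) x + spread (f i) z" if "i \<in> A k" for i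
    proof -
      have "f i (x b + z b) = f i (x b) + f i (z b)" if "b \<in> Basis" for b
        using f[OF \<open>i \<in> A k\<close>] xV[OF that] z(1)[OF that] unfolding functional_on_def by blast
      then show ?thesis by (simp add: spread_def scaleR_add_left sum.distrib)
    qed
    ultimately have "P (Suc k) (\<lambda>b. x b + z b) \<and> Q k x (\<lambda>b. x b + z b)"
      unfolding P_def Q_def using xV z by (auto intro!: add_V)
    then show "\<exists>x'. P (Suc k) x' \<and> Q k x x'" by blast
  qed
  then obtain x where P: "\<And>k. P k (x k)" and Q: "\<And>k. Q k (x k) (x (Suc k))" by blast
  have xV: "x k b \<in> V" if "b \<in> Basis" for k b using P[of k] that unfolding P_def by blast
  have geo: "summable (\<lambda>k. \<rho> * (1/2) ^ Suc k)" by (intro summable_mult) (simp add: summable_geometric)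
  have sume: "summable e"
    by (rule summable_comparison_test'[OF geo, of 0]) (use e in \<open>auto simp: less_imp_le\<close>)
  have "\<exists>s\<in>V. \<forall>n. nrm (s - x n b) \<le> (\<Sum>k. e (k + n))" if b: "b \<in> Basis" for b
    using Q b unfolding Q_def by (intro geometric_limit complete sume xV[OF b]) blast
  then obtain z where zV: "\<And>b. b \<in> Basis \<Longrightarrow> z b \<in> V"
    and z: "\<And>b n. b \<in> Basis \<Longrightarrow> nrm (z b - x n b) \<le> (\<Sum>k. e (k + n))" by metis
  have "nrm (z b) \<le> \<rho>" if b: "b \<in> Basis" for b
  proof -
    have "nrm (z b) \<le> (\<Sum>k. e k)" using z[OF b, of 0] P[of 0] unfolding P_def by simp
    also have "\<dots> \<le> (\<Sum>k. \<rho> * (1/2) ^ Suc k)" by (intro suminf_le e sume geo)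
    also have "\<dots> = \<rho>" using power_half_series by (metis sums_unique sums_mult mult.right_neutral)
    finally show ?thesis .
  qed
  moreover have "1/2 \<le> norm (spread (f i) z)" if i: "i \<in> A k" for k i
  proof -
    have dist: "\<bar>f i (z b) - f i (x (Suc k) b)\<bar> \<le> 1/32" if b: "b \<in> Basis" for b
    proof -
      have sumk: "summable (\<lambda>l. e (l + Suc k))" using sume by (simp only: summable_iff_shift)
      have K0: "0 \<le> K i"
      proof -
        have "1 \<le> K i * nrm (y i)" using K[OF i y(1)[OF i]] y(2)[OF i] by simp
        then show ?thesis using nrm_nonneg[OF y(1)[OF i]] by (metis mult_nonpos_nonneg not_one_le_zero order_trans linear)
      qed
      have "\<bar>f i (z b) - f i (x (Suc k) b)\<bar> = \<bar>f i (z b - x (Suc k) b)\<bar>"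
        by (simp add: functional_on_diff[OF f[OF i] V zV[OF b] xV[OF b]])
      also have "\<dots> \<le> K i * nrm (z b - x (Suc k) b)" by (intro K[OF i] diff_V zV xV b)
      also have "\<dots> \<le> K i * (\<Sum>l. e (l + Suc k))" by (intro mult_left_mono z b K0)
      also have "\<dots> = (\<Sum>l. K i * e (l + Suc k))" by (rule suminf_mult[OF sumk, symmetric])
      also have "\<dots> \<le> (\<Sum>l. (1/32) * (1/2) ^ Suc l)"
      proof (intro suminf_le summable_mult sumk)
        show "summable (\<lambda>l. (1/2::real) ^ Suc l)" by (simp add: summable_geometric)
        fix l
        have "K i * e (l + Suc k) \<le> (1/32) * (1/2) ^ (l + Suc k)" by (rule later[OF _ i]) simp
        also have "\<dots> \<le> (1/32) * (1/2) ^ Suc l" by (intro mult_left_mono power_decreasing) auto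
        finally show "K i * e (l + Suc k) \<le> (1/32) * (1/2) ^ Suc l" .
      qed
      also have "\<dots> = 1/32" using power_half_series by (metis sums_unique sums_mult mult.right_neutral)
      finally show ?thesis .
    qed
    have "norm (spread (f i) (x (Suc k)) - spread (f i) z)
      \<le> (\<Sum>b\<in>Basis. \<bar>(spread (f i) (x (Suc k)) - spread (f i) z) \<bullet> b\<bar>)" by (rule norm_le_l1)
    also have "\<dots> \<le> (\<Sum>b\<in>(Basis::R16 set). 1/32)"
      using dist by (intro sum_mono) (simp add: inner_diff_left spread_nth abs_minus_commute)
    also have "\<dots> = 1/2" by simp
    finally have "norm (spread (f i) (x (Suc k))) - norm (spread (f i) z) \<le> 1/2"
      using norm_triangle_ineq2 order_trans by blast
    moreover have "1 \<le> norm (spread (f i) (x (Suc k)))" using Q[of k] i unfolding Q_def by blast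
    ultimately show ?thesis by linarith
  qed
  ultimately show ?thesis using zV by blast
qed

text \<open>The conditions of \<open>block_planks\<close> ask that the weights of a block be tiny compared with quantities that depend on the previous
block, which fails for adjacent blocks of a slowly convergent series. With every second block left out it can be achieved: \<open>s (k + 1)\<close> is
chosen so large, depending on \<open>s k\<close> only, that the remainder of the series after it is small for all functionals up to \<open>s
k\<close>. The parameter \<open>r\<close> chooses the half to be kept, \<open>0\<close> for the even and \<open>1\<close> for the odd blocks.\<close>
lemma (in normed_carrier) alternating_planks:
  fixes I :: "nat set"
  assumes q: "0 < q" and smooth: "smooth_on V nrm q"
    and complete: "Metric_space.mcomplete V (norm_dist V nrm)"
    and f: "\<And>n. n \<in> I \<Longrightarrow> functional_on V (f n)"
    and K: "\<And>n x. n \<in> I \<Longrightarrow> x \<in> V \<Longrightarrow> \<bar>f n x\<bar> \<le> K n * nrm x"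
    and y: "\<And>n. n \<in> I \<Longrightarrow> y n \<in> V" "\<And>n. n \<in> I \<Longrightarrow> f n (y n) = 1"
    and sum: "summable (\<lambda>n. if n \<in> I then nrm (y n) powr q else 0)"
    and \<rho>: "0 < \<rho>" "\<rho> \<le> 1"
  shows "\<exists>s :: nat \<Rightarrow> nat. strict_mono s \<and> (\<forall>r. \<exists>z. (\<forall>b\<in>Basis. z b \<in> V \<and> nrm (z b) \<le> \<rho>) \<and>
    (\<forall>k. \<forall>n\<in>I \<inter> {s (2 * k + r)..<s (Suc (2 * k + r))}. 1/2 \<le> norm (spread (f n) z)))"
proof -
  define c where "c n = (if n \<in> I then nrm (y n) powr q else 0)" for n
  have c0: "0 \<le> c n" for n unfolding c_def by simp
  have sumc: "summable c" using sum unfolding c_def .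
  define T where "T m = (\<Sum>n. c (n + m))" for m
  have T: "\<exists>m>m0. 12800 * T m \<le> \<epsilon>" if "0 < \<epsilon>" for \<epsilon> :: real and m0
  proof -
    have "T \<longlonglongrightarrow> 0" unfolding T_def by (rule suminf_exist_split2[OF sumc])
    from LIMSEQ_D[OF this, of "\<epsilon> / 12800"] that
    obtain m1 where m1: "\<And>m. m \<ge> m1 \<Longrightarrow> norm (T m - 0) < \<epsilon> / 12800" by auto
    have "norm (T (max m1 (Suc m0)) - 0) < \<epsilon> / 12800" by (rule m1) simp
    then show ?thesis by (intro exI[of _ "max m1 (Suc m0)"]) (auto simp: less_max_iff_disj)
  qed
  define D where "D m = 1 + (\<Sum>n<m. \<bar>K n\<bar>)" for m
  have D1: "1 \<le> D m" for m unfolding D_def by (simp add: sum_nonneg)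
  have KD: "K n \<le> D m" if "n < m" for n m
  proof -
    have "\<bar>K n\<bar> \<le> (\<Sum>n<m. \<bar>K n\<bar>)" using that by (intro member_le_sum) auto
    then show ?thesis unfolding D_def by linarith
  qed
  \<comment> \<open>The size allowed to a correction: after multiplication by the bounds \<open>K n\<close> for \<open>n < m\<close>, the corrections add up to at most \<open>1/32\<close>.\<close>
  define E where "E k m = \<rho> * (1/2) ^ Suc k / (32 * D m)" for k m
  have E0: "0 < E k m" for k m unfolding E_def using \<rho> D1[of m] by simp
  have E1: "E k m \<le> \<rho> * (1/2) ^ Suc k" for k m
  proof -
    have "E k m \<le> \<rho> * (1/2) ^ Suc k / 1"
      unfolding E_def using \<rho> D1[of m] by (intro divide_left_mono) auto
    then show ?thesis by simp
  qed
  have "\<exists>s. \<forall>k::nat. True \<and> (s k < s (Suc k) \<and> 12800 * T (s (Suc k)) \<le> E (Suc k) (s k) powr q)"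
  proof (rule dependent_nat_choice)
    fix m k
    have "\<exists>m'>m. 12800 * T m' \<le> E (Suc k) m powr q"
      by (rule T) (use E0[of "Suc k" m] in simp)
    then show "\<exists>m'. True \<and> m < m' \<and> 12800 * T m' \<le> E (Suc k) m powr q" by simp
  qed simp
  then obtain s0 where s0: "\<And>k. s0 k < s0 (Suc k)" "\<And>k. 12800 * T (s0 (Suc k)) \<le> E (Suc k) (s0 k) powr q"
    by blast
  \<comment> \<open>\<open>s0 0\<close> comes without a bound on the remainder after it, hence the shift.\<close>
  define s where "s k = s0 (Suc k)" for k
  have mono0: "strict_mono s0" using s0(1) by (simp add: strict_mono_Suc_iff)
  have mono: "strict_mono s" using s0(1) by (simp add: strict_mono_Suc_iff s_def)
  have "\<exists>z. (\<forall>b\<in>Basis. z b \<in> V \<and> nrm (z b) \<le> \<rho>) \<and>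
    (\<forall>k. \<forall>n\<in>I \<inter> {s (2 * k + r)..<s (Suc (2 * k + r))}. 1/2 \<le> norm (spread (f n) z))" for r
  proof (rule block_planks[OF q smooth complete, where K = K and y = y
        and e = "\<lambda>k. E (Suc (2 * k + r)) (s0 (2 * k + r))"])
    fix k
    show "0 < E (Suc (2 * k + r)) (s0 (2 * k + r))" by (rule E0)
    have "E (Suc (2 * k + r)) (s0 (2 * k + r)) \<le> \<rho> * (1/2) ^ Suc (Suc (2 * k + r))" by (rule E1)
    also have "\<dots> \<le> \<rho> * (1/2) ^ Suc k" using \<rho> by (intro mult_left_mono power_decreasing) auto
    finally show "E (Suc (2 * k + r)) (s0 (2 * k + r)) \<le> \<rho> * (1/2) ^ Suc k" .
    let ?A = "I \<inter> {s (2 * k + r)..<s (Suc (2 * k + r))}"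
    have "(\<Sum>n\<in>?A. nrm (y n) powr q) = (\<Sum>n\<in>?A. c n)" by (intro sum.cong) (auto simp: c_def)
    also have "\<dots> \<le> (\<Sum>n\<in>{s (2 * k + r)..<s (Suc (2 * k + r))}. c n)"
      by (intro sum_mono2) (auto simp: c0)
    also have "\<dots> = (\<Sum>n<s (Suc (2 * k + r)) - s (2 * k + r). c (n + s (2 * k + r)))"
      by (simp add: sum.nat_ivl_Suc' sum.shift_bounds_nat_ivl[of c 0 "s (2 * k + r)", symmetric] strict_mono_less_eq[OF mono] flip: atLeast0LessThan)
    also have "\<dots> \<le> T (s (2 * k + r))"
      unfolding T_def using sumc by (intro sum_le_suminf) (auto simp: c0 summable_iff_shift)
    finally show "12800 * (\<Sum>n\<in>?A. nrm (y n) powr q) \<le> E (Suc (2 * k + r)) (s0 (2 * k + r)) powr q"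
      using s0(2)[of "2 * k + r"] unfolding s_def by linarith
    fix l n assume kl: "k < l" and n: "n \<in> ?A"
    have "Suc (Suc (2 * k + r)) \<le> 2 * l + r" using kl by simp
    then have "s0 (Suc (Suc (2 * k + r))) \<le> s0 (2 * l + r)" using mono0 by (simp add: strict_mono_less_eq)
    then have "n < s0 (2 * l + r)" using n unfolding s_def by simp
    then have "K n \<le> D (s0 (2 * l + r))" by (rule KD)
    then have "K n * E (Suc (2 * l + r)) (s0 (2 * l + r)) \<le> D (s0 (2 * l + r)) * E (Suc (2 * l + r)) (s0 (2 * l + r))"
      by (intro mult_right_mono less_imp_le[OF E0])
    also have "\<dots> = (1/32) * (\<rho> * (1/2) ^ Suc (Suc (2 * l + r)))"
      unfolding E_def using D1[of "s0 (2 * l + r)"] by simp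
    also have "\<dots> \<le> (1/32) * (1 * (1/2) ^ l)"
      using \<rho> by (intro mult_left_mono mult_mono power_decreasing) auto
    finally show "K n * E (Suc (2 * l + r)) (s0 (2 * l + r)) \<le> (1/32) * (1/2) ^ l" by simp
  qed (use f K y in auto)
  then show ?thesis using mono by blast
qed

section \<open>Norming and bounded functionals\<close>

definition sublinear_on :: "'a::real_vector set \<Rightarrow> ('a \<Rightarrow> real) \<Rightarrow> bool" where
  "sublinear_on V p \<longleftrightarrow> p 0 = 0 \<and> (\<forall>x\<in>V. \<forall>y\<in>V. p (x + y) \<le> p x + p y) \<and>
     (\<forall>x\<in>V. \<forall>a>0. p (a *\<^sub>R x) \<le> a * p x)"

text \<open>\<open>p\<close> is affine with slope \<open>r\<close> along every line in direction \<open>e\<close>. A sublinear function that is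
straight in several directions is linear on their span.\<close>
definition straight :: "'a::real_vector set \<Rightarrow> ('a \<Rightarrow> real) \<Rightarrow> 'a \<Rightarrow> real \<Rightarrow> bool" where
  "straight V p e r \<longleftrightarrow> (\<forall>x\<in>V. \<forall>s. p (x + s *\<^sub>R e) = p x + s * r)"

text \<open>A sublinear function can be lowered so as to become straight in a given direction \<open>y\<close>, without losing the directions in which
it is straight already. The new function is \<open>\<lambda>x. INF t. p (x + t y) - t p y\<close>, which removes the growth of \<open>p\<close> along
\<open>y\<close>.\<close>
lemma straighten:
  assumes V: "subspace V" and p: "sublinear_on V p" and y: "y \<in> V"
  shows "\<exists>p'. sublinear_on V p' \<and> (\<forall>x\<in>V. p' x \<le> p x) \<and> straight V p' y (p y) \<and>
    (\<forall>e\<in>V. \<forall>r. straight V p e r \<longrightarrow> straight V p' e r)"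
proof -
  have p0: "p 0 = 0" and pa: "\<And>x y. x \<in> V \<Longrightarrow> y \<in> V \<Longrightarrow> p (x + y) \<le> p x + p y"
    and ps: "\<And>x a. x \<in> V \<Longrightarrow> 0 < a \<Longrightarrow> p (a *\<^sub>R x) \<le> a * p x"
    using p unfolding sublinear_on_def by auto
  note add = subspace_add[OF V] and scale = subspace_scale[OF V] and neg = subspace_neg[OF V]
  have line: "t * p y \<le> p (t *\<^sub>R y)" for t
  proof (cases "0 < t")
    case True
    then show ?thesis using ps[OF scale[OF y], of "1 / t" t] by (simp add: field_simps)
  next
    case False
    have "p (t *\<^sub>R y + (- t) *\<^sub>R y) \<le> p (t *\<^sub>R y) + p ((- t) *\<^sub>R y)" by (intro pa scale y)
    then have "0 \<le> p (t *\<^sub>R y) + p ((- t) *\<^sub>R y)" using p0 by simp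
    moreover have "p ((- t) *\<^sub>R y) \<le> (- t) * p y"
      using ps[OF y, of "- t"] p0 False by (cases "t = 0") auto
    ultimately show ?thesis by simp
  qed
  define \<phi> where "\<phi> x t = p (x + t *\<^sub>R y) - t * p y" for x t
  define p' where "p' x = (INF t. \<phi> x t)" for x
  have bdd: "bdd_below (range (\<phi> x))" if x: "x \<in> V" for x
  proof (rule bdd_belowI)
    fix r assume "r \<in> range (\<phi> x)"
    then obtain t where r: "r = \<phi> x t" by blast
    have "p ((x + t *\<^sub>R y) + (- x)) \<le> p (x + t *\<^sub>R y) + p (- x)" by (intro pa add scale neg x y)
    then have "p (t *\<^sub>R y) \<le> p (x + t *\<^sub>R y) + p (- x)" by simp
    then show "- p (- x) \<le> r" unfolding r \<phi>_def using line[of t] by linarith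
  qed
  have le: "p' x \<le> \<phi> x t" if "x \<in> V" for x t
    unfolding p'_def by (rule cINF_lower[OF bdd[OF that]]) simp
  have ge: "m \<le> p' x" if "\<And>t. m \<le> \<phi> x t" for m x
    unfolding p'_def using that by (intro cINF_greatest) auto
  have p'p: "p' x \<le> p x" if "x \<in> V" for x using le[OF that, of 0] by (simp add: \<phi>_def)
  have str: "straight V p' e r"
    if e: "e \<in> V" and inv: "\<And>x s t. x \<in> V \<Longrightarrow> p' (x + s *\<^sub>R e) \<le> \<phi> x t + s * r" for e r
    unfolding straight_def
  proof (intro ballI allI antisym)
    have *: "p' (x + s *\<^sub>R e) - s * r \<le> p' x" if "x \<in> V" for x s
    proof (rule ge)
      fix t show "p' (x + s *\<^sub>R e) - s * r \<le> \<phi> x t" using inv[OF that, of s t] by linarith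
    qed
    fix x s assume x: "x \<in> V"
    show "p' (x + s *\<^sub>R e) \<le> p' x + s * r" using *[OF x, of s] by linarith
    show "p' x + s * r \<le> p' (x + s *\<^sub>R e)"
      using *[OF add[OF x scale[OF e]], of s "- s"] by simp
  qed
  have "sublinear_on V p'"
    unfolding sublinear_on_def
  proof (intro conjI ballI allI impI)
    show "p' 0 = 0"
    proof (rule antisym)
      show "p' 0 \<le> 0" using p'p[OF subspace_0[OF V]] p0 by simp
      show "0 \<le> p' 0" by (rule ge) (use line in \<open>simp add: \<phi>_def\<close>)
    qed
    fix x assume x: "x \<in> V"
    {
      fix x' assume x': "x' \<in> V"
      have *: "p' (x + x') \<le> \<phi> x t + \<phi> x' t'" for t t'
      proof -
        have "p ((x + t *\<^sub>R y) + (x' + t' *\<^sub>R y)) \<le> p (x + t *\<^sub>R y) + p (x' + t' *\<^sub>R y)"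
          by (intro pa add scale x x' y)
        then have "\<phi> (x + x') (t + t') \<le> \<phi> x t + \<phi> x' t'"
          unfolding \<phi>_def by (simp add: algebra_simps)
        then show ?thesis using le[OF add[OF x x'], of "t + t'"] by linarith
      qed
      have "p' (x + x') - \<phi> x' t' \<le> p' x" for t'
        by (rule ge) (use * in \<open>simp add: algebra_simps\<close>)
      then have "p' (x + x') - p' x \<le> p' x'"
        by (intro ge) (simp add: algebra_simps)
      then show "p' (x + x') \<le> p' x + p' x'" by simp
    }
    fix a :: real assume a: "0 < a"
    have "p' (a *\<^sub>R x) / a \<le> p' x"
    proof (rule ge)
      fix t
      have "p (a *\<^sub>R (x + t *\<^sub>R y)) \<le> a * p (x + t *\<^sub>R y)" by (intro ps add scale x y a)
      then have "\<phi> (a *\<^sub>R x) (a * t) \<le> a * \<phi> x t" unfolding \<phi>_def by (simp add: algebra_simps)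
      then have "p' (a *\<^sub>R x) \<le> a * \<phi> x t" using le[OF scale[OF x], of a "a * t"] by linarith
      then show "p' (a *\<^sub>R x) / a \<le> \<phi> x t" using a by (simp add: field_simps)
    qed
    then show "p' (a *\<^sub>R x) \<le> a * p' x" using a by (simp add: field_simps)
  qed
  moreover have "straight V p' y (p y)"
  proof (rule str[OF y])
    fix x s t assume x: "x \<in> V"
    show "p' (x + s *\<^sub>R y) \<le> \<phi> x t + s * p y"
      using le[OF add[OF x scale[OF y]], of s "t - s"] unfolding \<phi>_def by (simp add: algebra_simps)
  qed
  moreover have "straight V p' e r" if e: "e \<in> V" and s: "straight V p e r" for e r
  proof (rule str[OF e])
    fix x s t assume x: "x \<in> V"
    have "p ((x + t *\<^sub>R y) + s *\<^sub>R e) = p (x + t *\<^sub>R y) + s * r"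
      using \<open>straight V p e r\<close> add[OF x scale[OF y]] unfolding straight_def by blast
    then show "p' (x + s *\<^sub>R e) \<le> \<phi> x t + s * r"
      using le[OF add[OF x scale[OF e]], of s t] unfolding \<phi>_def by (simp add: algebra_simps)
  qed
  ultimately show ?thesis using p'p by blast
qed

lemma (in normed_carrier) sublinear_on_nrm: "sublinear_on V nrm"
  unfolding sublinear_on_def using nrm_0 nrm_add nrm_scale by auto

text \<open>Hahn-Banach for the span of \<open>u 0, \<dots>, u n\<close>, stated in coordinates. The norm is straightened first along the vector
\<open>y\<close> to be normed, which fixes the value there, and then along \<open>u 0, \<dots>, u n\<close>; the slopes are the coefficients
sought.\<close>
lemma (in normed_carrier) norming_coefficients:
  fixes u :: "nat \<Rightarrow> 'a" and d :: "nat \<Rightarrow> real"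
  assumes u: "\<And>k. u k \<in> V"
  shows "\<exists>g. (\<forall>c. \<bar>\<Sum>k\<le>n. c k * g k\<bar> \<le> nrm (\<Sum>k\<le>n. c k *\<^sub>R u k)) \<and>
    (\<Sum>k\<le>n. d k * g k) = nrm (\<Sum>k\<le>n. d k *\<^sub>R u k)"
proof -
  define y where "y = (\<Sum>k\<le>n. d k *\<^sub>R u k)"
  have yV: "y \<in> V" unfolding y_def by (intro sum_V scale_V u)
  have "\<exists>p g. sublinear_on V p \<and> (\<forall>x\<in>V. p x \<le> nrm x) \<and> straight V p y (nrm y) \<and>
    (\<forall>k<m. straight V p (u k) (g k))" for m
  proof (induction m)
    case 0
    show ?case using straighten[OF V sublinear_on_nrm yV] by auto
  next
    case (Suc m)
    then obtain p g where p: "sublinear_on V p" "\<forall>x\<in>V. p x \<le> nrm x" "straight V p y (nrm y)"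
      "\<forall>k<m. straight V p (u k) (g k)" by blast
    obtain p' where p': "sublinear_on V p'" "\<forall>x\<in>V. p' x \<le> p x" "straight V p' (u m) (p (u m))"
      "\<And>e r. e \<in> V \<Longrightarrow> straight V p e r \<Longrightarrow> straight V p' e r"
      using straighten[OF V p(1) u[of m]] by blast
    have "\<forall>k<Suc m. straight V p' (u k) ((g(m := p (u m))) k)"
      using p(4) p'(3,4) u by (auto simp: less_Suc_eq)
    moreover have "\<forall>x\<in>V. p' x \<le> nrm x" using p(2) p'(2) by force
    ultimately show ?case using p'(1,4) p(3) yV by blast
  qed
  then obtain p g where p: "sublinear_on V p" "\<And>x. x \<in> V \<Longrightarrow> p x \<le> nrm x" "straight V p y (nrm y)"
    "\<And>k. k < Suc n \<Longrightarrow> straight V p (u k) (g k)" by blast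
  have lin: "p (\<Sum>k<m. c k *\<^sub>R u k) = (\<Sum>k<m. c k * g k)" if "m \<le> Suc n" for m c
    using that
  proof (induction m)
    case 0
    then show ?case using p(1) by (simp add: sublinear_on_def)
  next
    case (Suc m)
    have "(\<Sum>k<m. c k *\<^sub>R u k) \<in> V" by (intro sum_V scale_V u)
    then have "p ((\<Sum>k<m. c k *\<^sub>R u k) + c m *\<^sub>R u m) = p (\<Sum>k<m. c k *\<^sub>R u k) + c m * g m"
      using p(4)[of m] Suc.prems unfolding straight_def by auto
    then show ?case using Suc by simp
  qed
  have lin: "p (\<Sum>k\<le>n. c k *\<^sub>R u k) = (\<Sum>k\<le>n. c k * g k)" for c
    using lin[of "Suc n"] by (simp add: lessThan_Suc_atMost)
  have up: "(\<Sum>k\<le>n. c k * g k) \<le> nrm (\<Sum>k\<le>n. c k *\<^sub>R u k)" for c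
    unfolding lin[symmetric] by (intro p(2) sum_V scale_V u)
  have "\<bar>\<Sum>k\<le>n. c k * g k\<bar> \<le> nrm (\<Sum>k\<le>n. c k *\<^sub>R u k)" for c
  proof -
    have "nrm (\<Sum>k\<le>n. (- c k) *\<^sub>R u k) = nrm (\<Sum>k\<le>n. c k *\<^sub>R u k)"
      using nrm_minus[of "\<Sum>k\<le>n. c k *\<^sub>R u k"] by (simp add: sum_negf sum_V scale_V u)
    then show ?thesis using up[of c] up[of "\<lambda>k. - c k"] by (simp add: sum_negf)
  qed
  moreover have "p (0 + 1 *\<^sub>R y) = p 0 + 1 * nrm y" using p(3) zero_V unfolding straight_def by blast
  then have "(\<Sum>k\<le>n. d k * g k) = nrm y" using lin[of d] p(1) unfolding y_def[symmetric] by (simp add: sublinear_on_def)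
  ultimately show ?thesis unfolding y_def by blast
qed

lemma (in normed_carrier) continuous_functional_bounded:
  assumes f: "functional_on V f" and cont: "continuous_map (norm_topology V nrm) euclideanreal f"
  shows "\<exists>M. \<forall>x\<in>V. \<bar>f x\<bar> \<le> M * nrm x"
proof -
  interpret M: Metric_space V "norm_dist V nrm" by (rule Metric_space_norm_dist[OF V N])
  have f0: "f 0 = 0" using f zero_V unfolding functional_on_def by (metis mult_zero_left scaleR_zero_left)
  have "openin M.mtopology {x \<in> V. f x \<in> ball 0 1}"
    using openin_continuous_map_preimage[OF cont, of "ball 0 1"] by (simp add: norm_topology_def)
  moreover have "0 \<in> {x \<in> V. f x \<in> ball 0 1}" using zero_V f0 by simp
  ultimately obtain r where r: "0 < r" "M.mball 0 r \<subseteq> {x \<in> V. f x \<in> ball 0 1}"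
    unfolding M.openin_mtopology by blast
  have small: "\<bar>f x\<bar> < 1" if "x \<in> V" "nrm x < r" for x
  proof -
    have "x \<in> M.mball 0 r" using that zero_V nrm_minus[of x] by (simp add: norm_dist_def)
    then show ?thesis using r(2) by (auto simp: dist_norm)
  qed
  have "\<bar>f x\<bar> \<le> (2 / r) * nrm x" if x: "x \<in> V" for x
  proof (cases "x = 0")
    case True
    then show ?thesis by (simp add: f0 nrm_0)
  next
    case False
    then have n: "0 < nrm x" by (rule nrm_pos[OF x])
    define a where "a = r / (2 * nrm x)"
    have a: "0 < a" unfolding a_def using n r(1) by simp
    have "nrm (a *\<^sub>R x) < r" unfolding nrm_scale[OF x] a_def using n r(1) by simp
    then have "\<bar>f (a *\<^sub>R x)\<bar> < 1" using small scale_V[OF x] by blast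
    then have "a * \<bar>f x\<bar> < 1" using f x a unfolding functional_on_def by (simp add: abs_mult)
    then show ?thesis using n r(1) unfolding a_def by (simp add: field_simps)
  qed
  then show ?thesis by blast
qed

section \<open>Partial sum operators of a filter basis\<close>
locale normed_filter_basis = normed_carrier V nrm
  for V :: "'a::real_vector set" and nrm :: "'a \<Rightarrow> real" +
  fixes F :: "nat filter" and u :: "nat \<Rightarrow> 'a"
  assumes free: "free_filter F"
    and basis: "filter_basis F V nrm u"
    and coords: "continuous_coords F V nrm u"
begin

abbreviation coef where "coef \<equiv> coord F V nrm u"
abbreviation psum where "psum \<equiv> partial_sum F V nrm u"

lemma u_V: "u k \<in> V" using basis unfolding filter_basis_def by blast

lemma eventually_ge_F: "eventually (\<lambda>n. m \<le> n) F"
proof -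
  have "finite (- {m..})" by (rule finite_subset[of _ "{..<m}"]) auto
  then have "eventually (\<lambda>n. n \<in> {m..}) F" using free unfolding free_filter_def by blast
  then show ?thesis by simp
qed

lemma expands_iff:
  "expands F V nrm u x c \<longleftrightarrow>
    x \<in> V \<and> (\<forall>\<epsilon>>0. eventually (\<lambda>n. nrm ((\<Sum>k\<le>n. c k *\<^sub>R u k) - x) < \<epsilon>) F)"
proof -
  interpret M: Metric_space V "norm_dist V nrm" by (rule Metric_space_norm_dist[OF V N])
  have "(\<Sum>k\<le>n. c k *\<^sub>R u k) \<in> V" for n by (intro sum_V scale_V u_V)
  then show ?thesis
    unfolding expands_def norm_topology_def M.limitin_metric by (auto simp: norm_dist_def)
qed

lemma coef_unique:
  assumes "expands F V nrm u x c" shows "coef k x = c k"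
proof -
  have "x \<in> V" using assms unfolding expands_iff by blast
  then have "\<exists>!c. expands F V nrm u x c" using basis unfolding filter_basis_def by blast
  then show ?thesis unfolding coord_def using assms by (simp add: the1_equality)
qed

lemma expands_coef:
  assumes "x \<in> V" shows "expands F V nrm u x (\<lambda>k. coef k x)"
proof -
  obtain c where c: "expands F V nrm u x c" using basis assms unfolding filter_basis_def by blast
  then have "(\<lambda>k. coef k x) = c" using coef_unique by blast
  then show ?thesis using c by simp
qed

lemma psum_converges:
  "x \<in> V \<Longrightarrow> 0 < \<epsilon> \<Longrightarrow> eventually (\<lambda>n. nrm (psum n x - x) < \<epsilon>) F"
  using expands_coef[of x] unfolding expands_iff partial_sum_def by blast

lemma functional_on_coef: "functional_on V (coef k)"
  unfolding functional_on_def
proof (intro conjI ballI allI)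
  fix x assume x: "x \<in> V"
  note ex = expands_coef[OF x, unfolded expands_iff, THEN conjunct2, rule_format]
  have SV: "(\<Sum>k\<le>n. c k *\<^sub>R u k) \<in> V" for n c by (intro sum_V scale_V u_V)
  {
    fix y assume y: "y \<in> V"
    note ey = expands_coef[OF y, unfolded expands_iff, THEN conjunct2, rule_format]
    have "expands F V nrm u (x + y) (\<lambda>k. coef k x + coef k y)"
      unfolding expands_iff
    proof (intro conjI allI impI add_V x y)
      fix \<epsilon> :: real assume "0 < \<epsilon>"
      then have e2: "0 < \<epsilon> / 2" by simp
      from eventually_conj[OF ex[OF e2] ey[OF e2]]
      show "eventually (\<lambda>n. nrm ((\<Sum>k\<le>n. (coef k x + coef k y) *\<^sub>R u k) - (x + y)) < \<epsilon>) F"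
      proof (rule eventually_mono)
        fix n
        let ?a = "(\<Sum>k\<le>n. coef k x *\<^sub>R u k) - x" and ?b = "(\<Sum>k\<le>n. coef k y *\<^sub>R u k) - y"
        assume "nrm ?a < \<epsilon> / 2 \<and> nrm ?b < \<epsilon> / 2"
        moreover have "nrm (?a + ?b) \<le> nrm ?a + nrm ?b" by (intro nrm_add diff_V SV x y)
        ultimately have "nrm (?a + ?b) < \<epsilon>" by linarith
        then show "nrm ((\<Sum>k\<le>n. (coef k x + coef k y) *\<^sub>R u k) - (x + y)) < \<epsilon>"
          by (simp add: scaleR_add_left sum.distrib algebra_simps)
      qed
    qed
    then show "coef k (x + y) = coef k x + coef k y" by (rule coef_unique)
  }
  fix a :: real
  have "expands F V nrm u (a *\<^sub>R x) (\<lambda>k. a * coef k x)"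
    unfolding expands_iff
  proof (intro conjI allI impI scale_V x)
    fix \<epsilon> :: real assume \<epsilon>: "0 < \<epsilon>"
    then have "0 < \<epsilon> / (\<bar>a\<bar> + 1)" by (simp add: add_nonneg_pos)
    from ex[OF this]
    show "eventually (\<lambda>n. nrm ((\<Sum>k\<le>n. (a * coef k x) *\<^sub>R u k) - a *\<^sub>R x) < \<epsilon>) F"
    proof (rule eventually_mono)
      fix n
      let ?a = "(\<Sum>k\<le>n. coef k x *\<^sub>R u k) - x"
      assume "nrm ?a < \<epsilon> / (\<bar>a\<bar> + 1)"
      then have "nrm ?a * (\<bar>a\<bar> + 1) < \<epsilon>" by (simp add: field_simps)
      then have "\<bar>a\<bar> * nrm ?a < \<epsilon>"
        using nrm_nonneg[OF diff_V[OF SV x, of "\<lambda>k. coef k x" n]] by (simp add: algebra_simps)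
      moreover have "(\<Sum>k\<le>n. (a * coef k x) *\<^sub>R u k) - a *\<^sub>R x = a *\<^sub>R ?a"
        by (simp add: scaleR_right_diff_distrib scaleR_sum_right)
      ultimately show "nrm ((\<Sum>k\<le>n. (a * coef k x) *\<^sub>R u k) - a *\<^sub>R x) < \<epsilon>"
        using nrm_scale[OF diff_V[OF SV x]] by simp
    qed
  qed
  then show "coef k (a *\<^sub>R x) = a * coef k x" by (rule coef_unique)
qed

lemma psum_V: "psum n x \<in> V"
  unfolding partial_sum_def by (intro sum_V scale_V u_V)

lemma psum_scale: "x \<in> V \<Longrightarrow> psum n (a *\<^sub>R x) = a *\<^sub>R psum n x"
  using functional_on_coef unfolding partial_sum_def functional_on_def by (simp add: scaleR_sum_right)

lemma psum_bounded: "\<exists>M. \<forall>x\<in>V. nrm (psum n x) \<le> M * nrm x"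
proof -
  have "\<exists>M. \<forall>x\<in>V. \<bar>coef k x\<bar> \<le> M * nrm x" for k
    using coords unfolding continuous_coords_def
    by (intro continuous_functional_bounded functional_on_coef) blast
  then obtain M where M: "\<And>k x. x \<in> V \<Longrightarrow> \<bar>coef k x\<bar> \<le> M k * nrm x" by metis
  have "nrm (psum n x) \<le> (\<Sum>k\<le>n. M k * nrm (u k)) * nrm x" if x: "x \<in> V" for x
  proof -
    have "nrm (psum n x) \<le> (\<Sum>k\<le>n. nrm (coef k x *\<^sub>R u k))"
      unfolding partial_sum_def by (intro nrm_sum scale_V u_V) simp
    also have "\<dots> \<le> (\<Sum>k\<le>n. M k * nrm x * nrm (u k))"
      unfolding nrm_scale[OF u_V] by (intro sum_mono mult_right_mono M x nrm_nonneg u_V)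
    also have "\<dots> = (\<Sum>k\<le>n. M k * nrm (u k)) * nrm x" unfolding sum_distrib_right by (simp add: ac_simps)
    finally show ?thesis .
  qed
  then show ?thesis by blast
qed

lemma expands_unit: "expands F V nrm u (u 0) (\<lambda>k. if k = 0 then 1 else 0)"
  unfolding expands_iff using u_V by (simp add: if_distrib[of "\<lambda>r. r *\<^sub>R _"] sum.delta nrm_0 cong: if_cong)

lemma u0_nonzero: "u 0 \<noteq> 0"
proof
  assume "u 0 = 0"
  moreover have "expands F V nrm u 0 (\<lambda>k. 0)" unfolding expands_iff by (simp add: zero_V nrm_0)
  ultimately show False using coef_unique[OF expands_unit, of 0] coef_unique[of 0 "\<lambda>k. 0" 0] by simp
qed

lemma psum_u0: "psum n (u 0) = u 0"
  unfolding partial_sum_def coef_unique[OF expands_unit]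
  by (simp add: if_distrib[of "\<lambda>r. r *\<^sub>R _"] sum.delta cong: if_cong)

lemma bdd_above_psum: "bdd_above ((\<lambda>x. nrm (psum n x) / nrm x) ` V)"
proof -
  obtain M where M: "\<And>x. x \<in> V \<Longrightarrow> nrm (psum n x) \<le> M * nrm x" using psum_bounded by blast
  have "nrm (psum n x) / nrm x \<le> \<bar>M\<bar>" if x: "x \<in> V" for x
  proof (cases "x = 0")
    case False
    then show ?thesis
      using M[OF x] nrm_pos[OF x] by (simp add: divide_le_eq) (meson abs_ge_self mult_right_mono order_trans less_imp_le)
  qed (simp add: nrm_0)
  then show ?thesis by (intro bdd_aboveI2)
qed

text \<open>All partial sum operators fix \<open>u 0\<close>.\<close>
lemma onorm_psum_ge_1: "1 \<le> onorm_on V nrm (psum n)"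
proof -
  have "nrm (psum n (u 0)) / nrm (u 0) \<le> onorm_on V nrm (psum n)"
    unfolding onorm_on_def by (rule cSUP_upper[OF u_V bdd_above_psum])
  then show ?thesis using nrm_pos[OF u_V u0_nonzero] by (simp add: psum_u0)
qed

lemma psum_almost_normed:
  "\<exists>x\<in>V. nrm (psum n x) = 1 \<and> nrm x \<le> 2 / onorm_on V nrm (psum n)"
proof -
  let ?a = "onorm_on V nrm (psum n)"
  have a: "1 \<le> ?a" by (rule onorm_psum_ge_1)
  then have "?a / 2 < (SUP x\<in>V. nrm (psum n x) / nrm x)" unfolding onorm_on_def by linarith
  then obtain x where x: "x \<in> V" "?a / 2 < nrm (psum n x) / nrm x"
    using less_cSUP_iff[OF _ bdd_above_psum] zero_V by blast
  have nx: "0 < nrm x"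
  proof (rule ccontr)
    assume "\<not> 0 < nrm x"
    then have "nrm x = 0" using nrm_nonneg[OF x(1)] by linarith
    then show False using x(2) a by simp
  qed
  then have p: "0 < nrm (psum n x)" using x(2) a nrm_nonneg[OF psum_V, of n x]
    by (cases "nrm (psum n x) = 0") auto
  define r where "r = 1 / nrm (psum n x)"
  have "nrm (psum n (r *\<^sub>R x)) = 1"
    unfolding psum_scale[OF x(1)] nrm_scale[OF psum_V] r_def using p by simp
  moreover have "nrm (r *\<^sub>R x) \<le> 2 / ?a"
    unfolding nrm_scale[OF x(1)] r_def using p x(2) nx a by (simp add: field_simps)
  ultimately show ?thesis using scale_V[OF x(1)] by blast
qed

text \<open>Compose a functional that norms \<open>psum n y\<close> with \<open>psum n\<close>, for a vector \<open>y\<close> at which the operator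
norm is attained up to a factor 2, scaled so that \<open>psum n y\<close> has norm 1.\<close>
lemma psum_norming_functional:
  "\<exists>f y. functional_on V f \<and> (\<forall>x\<in>V. \<bar>f x\<bar> \<le> nrm (psum n x)) \<and> y \<in> V \<and> f y = 1 \<and>
    nrm y \<le> 2 / onorm_on V nrm (psum n)"
proof -
  obtain y where y: "y \<in> V" "nrm (psum n y) = 1" "nrm y \<le> 2 / onorm_on V nrm (psum n)"
    using psum_almost_normed by blast
  obtain g where g: "\<And>c. \<bar>\<Sum>k\<le>n. c k * g k\<bar> \<le> nrm (\<Sum>k\<le>n. c k *\<^sub>R u k)"
    "(\<Sum>k\<le>n. coef k y * g k) = nrm (\<Sum>k\<le>n. coef k y *\<^sub>R u k)"
    using norming_coefficients[where u = u and n = n and d = "\<lambda>k. coef k y"] u_V by blast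
  define f where "f x = (\<Sum>k\<le>n. coef k x * g k)" for x
  have "functional_on V f"
    using functional_on_coef unfolding functional_on_def f_def
    by (auto simp: sum.distrib sum_distrib_left algebra_simps)
  moreover have "\<forall>x\<in>V. \<bar>f x\<bar> \<le> nrm (psum n x)" unfolding f_def partial_sum_def by (intro ballI g(1))
  moreover have "f y = 1" unfolding f_def g(2) using y(2) by (simp add: partial_sum_def)
  ultimately show ?thesis using y by blast
qed

end

section \<open>Admissibility in smooth spaces\<close>
lemma ennreal_infsum_finite_imp_summable:
  fixes a :: "nat \<Rightarrow> real"
  assumes a: "\<And>n. 0 \<le> a n" and fin: "(\<Sum>\<^sub>\<infinity>n\<in>I. ennreal (a n)) \<noteq> \<infinity>"
  shows "summable (\<lambda>n. if n \<in> I then a n else 0)"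
proof (rule bounded_imp_summable)
  let ?S = "\<Sum>\<^sub>\<infinity>n\<in>I. ennreal (a n)"
  show "0 \<le> (if n \<in> I then a n else 0)" for n using a by simp
  fix n
  have "ennreal (\<Sum>k\<le>n. if k \<in> I then a k else 0) = ennreal (\<Sum>k\<in>{..n} \<inter> I. a k)"
    by (simp add: sum.inter_restrict)
  also have "\<dots> = (\<Sum>k\<in>{..n} \<inter> I. ennreal (a k))" using a by (simp add: sum_ennreal)
  also have "\<dots> \<le> (SUP A\<in>{A. finite A \<and> A \<subseteq> I}. \<Sum>k\<in>A. ennreal (a k))"
    by (intro SUP_upper) auto
  also have "\<dots> = ?S" by (rule nonneg_infsum_complete[symmetric]) simp
  also have "?S = ennreal (enn2real ?S)" using fin by (simp add: top.not_eq_extremum)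
  finally show "(\<Sum>k\<le>n. if k \<in> I then a k else 0) \<le> enn2real ?S"
    by (rule ennreal_le_iff[THEN iffD1, rotated]) simp
qed

text \<open>If \<open>n\<close> lies in the half of \<open>I\<close> treated by the vectors \<open>z b\<close>, then some \<open>\<bar>f n (z
b)\<bar>\<close> is at least \<open>1/32\<close>, for otherwise \<open>spread (f n) z\<close> would have norm below \<open>16/32\<close>. But
\<open>psum n (z b)\<close> is within \<open>1/64\<close> of a vector of norm at most \<open>1/64\<close> for all \<open>b\<close> and
\<open>F\<close>-almost all \<open>n\<close>. Hence \<open>F\<close>-almost no \<open>n\<close> lies in either half, and \<open>I\<close> is not
stationary.\<close>
lemma (in normed_filter_basis) smooth_imp_admissible:
  assumes q: "0 < q" and smooth: "smooth_on V nrm q"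
    and complete: "Metric_space.mcomplete V (norm_dist V nrm)"
  shows "admissible F q (\<lambda>n. onorm_on V nrm (psum n))"
  unfolding admissible_def
proof (intro conjI allI impI)
  let ?a = "\<lambda>n. onorm_on V nrm (psum n)"
  have apos: "0 < ?a n" for n using onorm_psum_ge_1[of n] by linarith
  then show "0 < ?a n" for n .
  fix I assume I: "stationary F I"
  show "(\<Sum>\<^sub>\<infinity>n\<in>I. ennreal (?a n powr (- q))) = \<infinity>"
  proof (rule ccontr)
    assume "\<not> ?thesis"
    then have suma: "summable (\<lambda>n. if n \<in> I then ?a n powr (- q) else 0)"
      by (intro ennreal_infsum_finite_imp_summable) auto
    obtain f y where f: "\<And>n. functional_on V (f n)" and fS: "\<And>n x. x \<in> V \<Longrightarrow> \<bar>f n x\<bar> \<le> nrm (psum n x)"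
      and yV: "\<And>n. y n \<in> V" and fy: "\<And>n. f n (y n) = 1" and ny: "\<And>n. nrm (y n) \<le> 2 / ?a n"
      using psum_norming_functional by metis
    obtain K where K: "\<And>n x. x \<in> V \<Longrightarrow> nrm (psum n x) \<le> K n * nrm x" using psum_bounded by metis
    have "summable (\<lambda>n. 2 powr q * (if n \<in> I then ?a n powr (- q) else 0))"
      by (rule summable_mult[OF suma])
    then have "summable (\<lambda>n. if n \<in> I then nrm (y n) powr q else 0)"
    proof (rule summable_comparison_test'[where N = 0])
      fix n
      have "nrm (y n) powr q \<le> (2 / ?a n) powr q" using q ny nrm_nonneg[OF yV] by (intro powr_mono2) auto
      also have "\<dots> = 2 powr q * ?a n powr (- q)"
        using apos[of n] by (simp add: powr_divide powr_minus_divide)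
      finally show "norm (if n \<in> I then nrm (y n) powr q else 0) \<le> 2 powr q * (if n \<in> I then ?a n powr (- q) else 0)"
        by simp
    qed
    note sumy = this
    have "\<exists>s :: nat \<Rightarrow> nat. strict_mono s \<and> (\<forall>r. \<exists>z. (\<forall>b\<in>Basis. z b \<in> V \<and> nrm (z b) \<le> 1/64) \<and>
        (\<forall>k. \<forall>n\<in>I \<inter> {s (2 * k + r)..<s (Suc (2 * k + r))}. 1/2 \<le> norm (spread (f n) z)))"
    proof (rule alternating_planks[OF q smooth complete f _ yV fy sumy])
      show "\<bar>f n x\<bar> \<le> K n * nrm x" if "x \<in> V" for n x using fS[OF that, of n] K[OF that, of n] by linarith
    qed auto
    then obtain s where s: "strict_mono s" and
      sz: "\<And>r. \<exists>z. (\<forall>b\<in>Basis. z b \<in> V \<and> nrm (z b) \<le> 1/64) \<and>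
        (\<forall>k. \<forall>n\<in>I \<inter> {s (2 * k + r)..<s (Suc (2 * k + r))}. 1/2 \<le> norm (spread (f n) z))"
      by (elim exE conjE) (rule that, assumption, erule allE)
    have ev: "eventually (\<lambda>n. \<forall>k. n \<notin> I \<inter> {s (2 * k + r)..<s (Suc (2 * k + r))}) F" for r
    proof -
      obtain z where z: "\<And>b. b \<in> Basis \<Longrightarrow> z b \<in> V" "\<And>b. b \<in> Basis \<Longrightarrow> nrm (z b) \<le> 1/64"
        "\<And>k n. n \<in> I \<inter> {s (2 * k + r)..<s (Suc (2 * k + r))} \<Longrightarrow> 1/2 \<le> norm (spread (f n) z)"
        using sz[of r] by blast
      have "eventually (\<lambda>n. \<forall>b\<in>Basis. nrm (psum n (z b) - z b) < 1/64) F"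
        by (intro eventually_ball_finite ballI psum_converges z) auto
      then show ?thesis
      proof (rule eventually_mono)
        fix n assume near: "\<forall>b\<in>Basis. nrm (psum n (z b) - z b) < 1/64"
        have "\<bar>f n (z b)\<bar> < 1/32" if b: "b \<in> Basis" for b
        proof -
          have "nrm ((psum n (z b) - z b) + z b) \<le> nrm (psum n (z b) - z b) + nrm (z b)"
            by (intro nrm_add diff_V psum_V z b)
          then show ?thesis using fS[OF z(1)[OF b], of n] near z(2)[OF b] b by fastforce
        qed
        then have "(\<Sum>b\<in>Basis. \<bar>f n (z b)\<bar>) < (\<Sum>b\<in>(Basis::R16 set). 1/32)"
          by (intro sum_strict_mono) auto
        moreover have "norm (spread (f n) z) \<le> (\<Sum>b\<in>Basis. \<bar>f n (z b)\<bar>)"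
          using norm_le_l1[of "spread (f n) z"] by (simp add: spread_nth)
        ultimately have "norm (spread (f n) z) < 1/2" by simp
        then show "\<forall>k. n \<notin> I \<inter> {s (2 * k + r)..<s (Suc (2 * k + r))}" using z(3) by force
      qed
    qed
    have "eventually (\<lambda>n. n \<in> - I) F"
      using eventually_ge_F[of "s 0"] ev[of 0] ev[of 1]
    proof eventually_elim
      case (elim n)
      have "\<exists>m. s m \<le> n \<and> n < s (Suc m)"
      proof -
        define m where "m = (GREATEST m. s m \<le> n)"
        have bound: "m \<le> n" if "s m \<le> n" for m using strict_mono_imp_increasing[OF s, of m] that by linarith
        have "s m \<le> n" unfolding m_def by (rule GreatestI_nat[of _ 0 n]) (use elim bound in auto)
        moreover have "\<not> s (Suc m) \<le> n"
        proof
          assume "s (Suc m) \<le> n"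
          then have "Suc m \<le> m" unfolding m_def using bound by (intro Greatest_le_nat[of _ _ n]) auto
          then show False by simp
        qed
        ultimately show ?thesis by auto
      qed
      then obtain m where m: "s m \<le> n" "n < s (Suc m)" by blast
      have "m = 2 * (m div 2) + 0 \<or> m = 2 * (m div 2) + 1" by presburger
      then obtain k where "m = 2 * k + 0 \<or> m = 2 * k + 1" by blast
      then show ?case using elim m by auto
    qed
    then show False using I unfolding stationary_def by blast
  qed
qed

section \<open>The spaces \<open>\<ell>\<^sub>p\<close> are smooth Banach spaces\<close>

lemma powr_convex_nonneg:
  fixes a b l m p :: real
  assumes p: "1 \<le> p" and ab: "0 \<le> a" "0 \<le> b" and lm: "0 \<le> l" "0 \<le> m" "l + m = 1"
  shows "(l * a + m * b) powr p \<le> l * a powr p + m * b powr p"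
proof -
  have one: "(k * c) powr p \<le> k * c powr p" if "0 \<le> k" "k \<le> 1" "0 \<le> c" for k c :: real
  proof -
    have "k powr p \<le> k powr 1" using that p by (intro powr_mono') auto
    then have "k powr p \<le> k" using that by simp
    then show ?thesis using that by (simp add: powr_mult mult_right_mono)
  qed
  consider "a = 0" | "b = 0" | "0 < a" "0 < b" using ab by linarith
  then show ?thesis
  proof cases
    case 1
    then show ?thesis using one[of m b] lm ab p by simp
  next
    case 2
    then show ?thesis using one[of l a] lm ab p by simp
  next
    case 3
    then show ?thesis
      using powr_convex[OF p] lm unfolding convex_on_def by auto
  qed
qed

lemma powr_concave_mean:
  fixes a b r :: real
  assumes r: "0 < r" "r \<le> 1" and ab: "0 \<le> a" "0 \<le> b"
  shows "a powr r + b powr r \<le> 2 * ((a + b) / 2) powr r"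
proof -
  have e: "(c powr r) powr (1 / r) = c" if "0 \<le> c" for c using that r by (simp add: powr_powr)
  have "((1/2) * a powr r + (1/2) * b powr r) powr (1 / r) \<le> (1/2) * (a powr r) powr (1 / r) + (1/2) * (b powr r) powr (1 / r)"
    using r by (intro powr_convex_nonneg) auto
  then have "(((1/2) * a powr r + (1/2) * b powr r) powr (1 / r)) powr r \<le> ((a + b) / 2) powr r"
    unfolding e[OF ab(1)] e[OF ab(2)] using r by (intro powr_mono2) auto
  then show ?thesis using r by (simp add: powr_powr)
qed

lemma powr_subadditive:
  fixes a b r :: real
  assumes r: "0 < r" "r \<le> 1" and ab: "0 \<le> a" "0 \<le> b"
  shows "(a + b) powr r \<le> a powr r + b powr r"
proof (cases "a + b = 0")
  case True
  then show ?thesis by simp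
next
  case False
  define t where "t = a + b"
  have t: "0 < t" using False ab unfolding t_def by linarith
  have "c / t * t powr r \<le> c powr r" if c: "0 \<le> c" "c \<le> t" for c
  proof -
    have "(c / t) powr 1 \<le> (c / t) powr r" using c t r by (intro powr_mono') auto
    then have "c / t \<le> (c / t) powr r" using c t by simp
    then have "c / t * t powr r \<le> (c / t) powr r * t powr r" by (intro mult_right_mono) auto
    also have "\<dots> = c powr r" using c t by (simp add: powr_divide)
    finally show ?thesis .
  qed
  from this[of a] this[of b] have "(a / t + b / t) * t powr r \<le> a powr r + b powr r"
    using ab unfolding t_def by (simp add: distrib_right)
  then show ?thesis using t unfolding t_def by (simp flip: add_divide_distrib)
qed

text \<open>A weak form of Clarkson's inequality: by concavity of \<open>t powr (q/2)\<close> the left side is at most \<open>2 (a\<^sup>2 +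
s\<^sup>2) powr (q/2)\<close>, and that power is subadditive. It holds up to \<open>q = 2\<close>, where it is the parallelogram law.\<close>
lemma powr_two_point:
  fixes a s q :: real
  assumes q: "0 < q" "q \<le> 2"
  shows "\<bar>a + s\<bar> powr q + \<bar>a - s\<bar> powr q \<le> 2 * \<bar>a\<bar> powr q + 2 * \<bar>s\<bar> powr q"
proof -
  have sq: "(x\<^sup>2) powr (q / 2) = \<bar>x\<bar> powr q" for x :: real
  proof -
    have "x\<^sup>2 = \<bar>x\<bar> powr 2" by (cases "x = 0") (simp_all add: powr_numeral)
    then show ?thesis by (simp only: powr_powr) simp
  qed
  have "\<bar>a + s\<bar> powr q + \<bar>a - s\<bar> powr q = ((a + s)\<^sup>2) powr (q / 2) + ((a - s)\<^sup>2) powr (q / 2)"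
    by (simp only: sq)
  also have "\<dots> \<le> 2 * (((a + s)\<^sup>2 + (a - s)\<^sup>2) / 2) powr (q / 2)"
    using q by (intro powr_concave_mean) auto
  also have "((a + s)\<^sup>2 + (a - s)\<^sup>2) / 2 = a\<^sup>2 + s\<^sup>2" by (simp add: power2_eq_square algebra_simps)
  also have "(a\<^sup>2 + s\<^sup>2) powr (q / 2) \<le> (a\<^sup>2) powr (q / 2) + (s\<^sup>2) powr (q / 2)"
    using q by (intro powr_subadditive) auto
  finally show ?thesis by (simp only: sq) simp
qed

lemma lp_norm_powr:
  assumes x: "x \<in> lp p" and p: "0 < p"
  shows "lp_norm p x powr p = (\<Sum>n. \<bar>x n\<bar> powr p)"
proof -
  have "0 \<le> (\<Sum>n. \<bar>x n\<bar> powr p)" using x unfolding lp_def by (intro suminf_nonneg) auto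
  then show ?thesis unfolding lp_norm_def using p by (simp add: powr_powr)
qed

lemma lp_norm_nonneg: "0 \<le> lp_norm p x"
  unfolding lp_norm_def by simp

text \<open>Bounds on partial sums give membership and norm at once; Minkowski's inequality and completeness use this form.\<close>
lemma lp_norm_leI:
  assumes p: "0 < p" and C: "0 \<le> C" and part: "\<And>M. (\<Sum>i<M. \<bar>x i\<bar> powr p) \<le> C powr p"
  shows "x \<in> lp p" "lp_norm p x \<le> C"
proof -
  show x: "x \<in> lp p"
    unfolding lp_def mem_Collect_eq
    by (rule bounded_imp_summable[where B = "C powr p"]) (use part[of "Suc _"] in \<open>simp_all add: lessThan_Suc_atMost\<close>)
  have "(\<Sum>n. \<bar>x n\<bar> powr p) \<le> C powr p"
    using x part unfolding lp_def by (intro suminf_le_const) auto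
  then have "lp_norm p x powr p \<le> C powr p" using lp_norm_powr[OF x p] by simp
  then show "lp_norm p x \<le> C" using powr_less_mono2[OF p C, of "lp_norm p x"] by linarith
qed

lemma lp_partial_le:
  assumes "0 < p" "x \<in> lp p"
  shows "(\<Sum>i<M. \<bar>x i\<bar> powr p) \<le> lp_norm p x powr p"
  unfolding lp_norm_powr[OF assms(2,1)] using assms(2) unfolding lp_def by (intro sum_le_suminf) auto

lemma lp_component_le:
  assumes p: "0 < p" and x: "x \<in> lp p" shows "\<bar>x i\<bar> \<le> lp_norm p x"
proof -
  have "\<bar>x i\<bar> powr p \<le> (\<Sum>i<Suc i. \<bar>x i\<bar> powr p)" by (intro member_le_sum) auto
  also have "\<dots> \<le> lp_norm p x powr p" by (rule lp_partial_le[OF p x])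
  finally show ?thesis using powr_less_mono2[OF p lp_norm_nonneg, of p x "\<bar>x i\<bar>"] by linarith
qed

lemma lp_scale:
  assumes p: "0 < p" and x: "x \<in> lp p"
  shows "a *\<^sub>R x \<in> lp p" "lp_norm p (a *\<^sub>R x) = \<bar>a\<bar> * lp_norm p x"
proof -
  have e: "\<bar>(a *\<^sub>R x) n\<bar> powr p = \<bar>a\<bar> powr p * \<bar>x n\<bar> powr p" for n
    by (simp add: scaleR_fun_def abs_mult powr_mult)
  have s: "summable (\<lambda>n. \<bar>x n\<bar> powr p)" using x unfolding lp_def by simp
  then show "a *\<^sub>R x \<in> lp p" unfolding lp_def mem_Collect_eq e by (rule summable_mult)
  show "lp_norm p (a *\<^sub>R x) = \<bar>a\<bar> * lp_norm p x"
    unfolding lp_norm_def e suminf_mult[OF s] using p suminf_nonneg[OF s]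
    by (simp add: powr_mult powr_powr)
qed

lemma lp_add:
  assumes p: "1 \<le> p" and x: "x \<in> lp p" and y: "y \<in> lp p"
  shows "x + y \<in> lp p" "lp_norm p (x + y) \<le> lp_norm p x + lp_norm p y"
proof -
  have p0: "0 < p" using p by simp
  define A where "A = lp_norm p x"
  define B where "B = lp_norm p y"
  have AB: "0 \<le> A" "0 \<le> B" unfolding A_def B_def by (rule lp_norm_nonneg)+
  have part: "(\<Sum>i<M. \<bar>(x + y) i\<bar> powr p) \<le> (A + B) powr p" for M
  proof -
    consider "A = 0" | "B = 0" | "0 < A" "0 < B" using AB by linarith
    then show ?thesis
    proof cases
      case 1
      then have "x i = 0" for i using lp_component_le[OF p0 x, of i] unfolding A_def by simp
      then show ?thesis using lp_partial_le[OF p0 y, of M] 1 by (simp add: B_def)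
    next
      case 2
      then have "y i = 0" for i using lp_component_le[OF p0 y, of i] unfolding B_def by simp
      then show ?thesis using lp_partial_le[OF p0 x, of M] 2 by (simp add: A_def)
    next
      case 3
      define T where "T = A + B"
      have T: "0 < T" using 3 unfolding T_def by simp
      have *: "\<bar>(x + y) i\<bar> powr p \<le> T powr p * ((A / T) * (\<bar>x i\<bar> powr p / A powr p) + (B / T) * (\<bar>y i\<bar> powr p / B powr p))" for i
      proof -
        have "\<bar>x i + y i\<bar> \<le> T * ((A / T) * (\<bar>x i\<bar> / A) + (B / T) * (\<bar>y i\<bar> / B))"
          using 3 T by (simp add: distrib_left)
        then have "\<bar>(x + y) i\<bar> powr p \<le> (T * ((A / T) * (\<bar>x i\<bar> / A) + (B / T) * (\<bar>y i\<bar> / B))) powr p"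
          using p0 by (intro powr_mono2) auto
        also have "\<dots> = T powr p * ((A / T) * (\<bar>x i\<bar> / A) + (B / T) * (\<bar>y i\<bar> / B)) powr p"
          using 3 T by (intro powr_mult)
        also have "\<dots> \<le> T powr p * ((A / T) * (\<bar>x i\<bar> / A) powr p + (B / T) * (\<bar>y i\<bar> / B) powr p)"
          using 3 T by (intro mult_left_mono powr_convex_nonneg p) (auto simp: T_def simp flip: add_divide_distrib)
        finally show ?thesis using 3 by (simp add: powr_divide)
      qed
      have "(\<Sum>i<M. \<bar>(x + y) i\<bar> powr p) \<le>
        (\<Sum>i<M. T powr p * ((A / T) * (\<bar>x i\<bar> powr p / A powr p) + (B / T) * (\<bar>y i\<bar> powr p / B powr p)))"
        by (intro sum_mono *)
      also have "\<dots> = T powr p * ((A / T) * ((\<Sum>i<M. \<bar>x i\<bar> powr p) / A powr p) + (B / T) * ((\<Sum>i<M. \<bar>y i\<bar> powr p) / B powr p))"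
        by (simp only: sum.distrib sum_distrib_left sum_divide_distrib distrib_left)
      also have "\<dots> \<le> T powr p * ((A / T) * 1 + (B / T) * 1)"
        using 3 T lp_partial_le[OF p0 x, of M] lp_partial_le[OF p0 y, of M]
        by (intro mult_left_mono add_mono) (auto simp: A_def B_def divide_le_eq)
      also have "\<dots> = (A + B) powr p" using T unfolding T_def by (simp flip: add_divide_distrib)
      finally show ?thesis .
    qed
  qed
  have "0 \<le> A + B" using AB by simp
  from lp_norm_leI[OF p0 this part] show "x + y \<in> lp p" "lp_norm p (x + y) \<le> lp_norm p x + lp_norm p y"
    unfolding A_def B_def by blast+
qed

lemma zero_in_lp: "0 \<in> lp p"
  unfolding lp_def by (simp add: zero_fun_def)

lemma subspace_lp: "1 \<le> p \<Longrightarrow> subspace (lp p)"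
  unfolding subspace_def using lp_add(1) lp_scale(1) zero_in_lp by simp

lemma norm_on_lp:
  assumes p: "1 \<le> p" shows "norm_on (lp p) (lp_norm p)"
proof -
  have p0: "0 < p" using p by simp
  have "lp_norm p x = 0 \<longleftrightarrow> x = 0" if x: "x \<in> lp p" for x
  proof
    assume "lp_norm p x = 0"
    then have "x i = 0" for i using lp_component_le[OF p0 x, of i] by simp
    then show "x = 0" by (simp add: fun_eq_iff)
  next
    assume "x = 0"
    then show "lp_norm p x = 0" using p0 by (simp add: lp_norm_def zero_fun_def)
  qed
  then show ?thesis unfolding norm_on_def using lp_norm_nonneg lp_scale(2)[OF p0] lp_add(2)[OF p] by simp
qed

lemma banach_on_lp:
  assumes p: "1 \<le> p" shows "banach_on (lp p) (lp_norm p)"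
  unfolding banach_on_def
proof (intro conjI subspace_lp norm_on_lp p)
  have p0: "0 < p" using p by simp
  interpret N: normed_carrier "lp p" "lp_norm p" by (unfold_locales) (intro subspace_lp norm_on_lp p)+
  interpret M: Metric_space "lp p" "norm_dist (lp p) (lp_norm p)"
    by (rule Metric_space_norm_dist[OF N.V N.N])
  show "M.mcomplete"
    unfolding M.mcomplete_def
  proof (intro allI impI)
    fix \<sigma> assume "M.MCauchy \<sigma>"
    then have \<sigma>: "\<And>n. \<sigma> n \<in> lp p"
      and "\<And>\<epsilon>. 0 < \<epsilon> \<Longrightarrow> \<exists>N. \<forall>n n'. N \<le> n \<longrightarrow> N \<le> n' \<longrightarrow> norm_dist (lp p) (lp_norm p) (\<sigma> n) (\<sigma> n') < \<epsilon>"
      unfolding M.MCauchy_def by auto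
    then have cau: "\<exists>N. \<forall>n n'. N \<le> n \<longrightarrow> N \<le> n' \<longrightarrow> lp_norm p (\<sigma> n - \<sigma> n') < \<epsilon>" if "0 < \<epsilon>" for \<epsilon>
      using that by (simp add: norm_dist_def)
    have "Cauchy (\<lambda>n. \<sigma> n i)" for i
      unfolding Cauchy_def
    proof (intro allI impI)
      fix \<epsilon> :: real assume "0 < \<epsilon>"
      then obtain N where N: "\<And>n n'. N \<le> n \<Longrightarrow> N \<le> n' \<Longrightarrow> lp_norm p (\<sigma> n - \<sigma> n') < \<epsilon>" using cau by blast
      have "dist (\<sigma> n i) (\<sigma> n' i) < \<epsilon>" if "N \<le> n" "N \<le> n'" for n n'
        using lp_component_le[OF p0 N.diff_V[OF \<sigma> \<sigma>], of n n' i] N[OF that] by (simp add: dist_real_def)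
      then show "\<exists>N. \<forall>n\<ge>N. \<forall>n'\<ge>N. dist (\<sigma> n i) (\<sigma> n' i) < \<epsilon>" by blast
    qed
    then have "\<exists>l. (\<lambda>n. \<sigma> n i) \<longlonglongrightarrow> l" for i using real_Cauchy_convergent convergent_def by blast
    then obtain x where x: "\<And>i. (\<lambda>n. \<sigma> n i) \<longlonglongrightarrow> x i" by metis
    have close: "\<exists>N. \<forall>n\<ge>N. \<sigma> n - x \<in> lp p \<and> lp_norm p (\<sigma> n - x) \<le> \<epsilon>" if \<epsilon>: "0 < \<epsilon>" for \<epsilon>
    proof -
      obtain N where N: "\<And>n n'. N \<le> n \<Longrightarrow> N \<le> n' \<Longrightarrow> lp_norm p (\<sigma> n - \<sigma> n') < \<epsilon>" using cau[OF \<epsilon>] by blast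
      have "(\<Sum>i<M. \<bar>(\<sigma> n - x) i\<bar> powr p) \<le> \<epsilon> powr p" if n: "N \<le> n" for n M
      proof (rule LIMSEQ_le_const2)
        show "(\<lambda>n'. \<Sum>i<M. \<bar>(\<sigma> n - \<sigma> n') i\<bar> powr p) \<longlonglongrightarrow> (\<Sum>i<M. \<bar>(\<sigma> n - x) i\<bar> powr p)"
          unfolding fun_diff_def using p0 by (intro tendsto_intros tendsto_powr2 x) auto
        have "(\<Sum>i<M. \<bar>(\<sigma> n - \<sigma> n') i\<bar> powr p) \<le> \<epsilon> powr p" if n': "N \<le> n'" for n'
        proof -
          have "(\<Sum>i<M. \<bar>(\<sigma> n - \<sigma> n') i\<bar> powr p) \<le> lp_norm p (\<sigma> n - \<sigma> n') powr p"
            by (intro lp_partial_le p0 N.diff_V \<sigma>)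
          also have "\<dots> \<le> \<epsilon> powr p" using p0 N[OF n n'] lp_norm_nonneg by (intro powr_mono2) (auto simp: less_imp_le)
          finally show ?thesis .
        qed
        then show "\<exists>N. \<forall>n'\<ge>N. (\<Sum>i<M. \<bar>(\<sigma> n - \<sigma> n') i\<bar> powr p) \<le> \<epsilon> powr p" by blast
      qed
      then have "\<sigma> n - x \<in> lp p \<and> lp_norm p (\<sigma> n - x) \<le> \<epsilon>" if "N \<le> n" for n
        using lp_norm_leI[OF p0 less_imp_le[OF \<epsilon>]] that by blast
      then show ?thesis by blast
    qed
    have xV: "x \<in> lp p"
    proof -
      obtain n where "\<sigma> n - x \<in> lp p" using close[of 1] by auto
      then have "\<sigma> n - (\<sigma> n - x) \<in> lp p" by (rule N.diff_V[OF \<sigma>])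
      then show ?thesis by (simp only: diff_diff_eq2 add_diff_cancel_left')
    qed
    have "\<exists>N. \<forall>n\<ge>N. \<sigma> n \<in> lp p \<and> norm_dist (lp p) (lp_norm p) (\<sigma> n) x < \<epsilon>" if \<epsilon>: "0 < \<epsilon>" for \<epsilon>
    proof -
      obtain N where "\<forall>n\<ge>N. lp_norm p (\<sigma> n - x) \<le> \<epsilon> / 2" using close[OF half_gt_zero[OF \<epsilon>]] by blast
      then have "\<forall>n\<ge>N. lp_norm p (\<sigma> n - x) < \<epsilon>" using \<epsilon> by fastforce
      then show ?thesis using \<sigma> xV by (auto simp: norm_dist_def)
    qed
    then show "\<exists>x. limitin M.mtopology \<sigma> x sequentially"
      unfolding M.limit_metric_sequentially using xV by blast
  qed
qed

lemma smooth_on_lp: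
  assumes p: "1 \<le> p" "p \<le> 2" shows "smooth_on (lp p) (lp_norm p) p"
  unfolding smooth_on_def
proof (intro ballI)
  fix x y assume x: "x \<in> lp p" and y: "y \<in> lp p"
  have p0: "0 < p" using p by simp
  have V: "x + y \<in> lp p" "x - y \<in> lp p"
    using x y subspace_lp[OF p(1)] by (auto intro: subspace_add subspace_diff)
  have S: "summable (\<lambda>n. \<bar>z n\<bar> powr p)" if "z \<in> lp p" for z using that unfolding lp_def by simp
  have "lp_norm p (x + y) powr p + lp_norm p (x - y) powr p = (\<Sum>n. \<bar>(x + y) n\<bar> powr p + \<bar>(x - y) n\<bar> powr p)"
    unfolding lp_norm_powr[OF V(1) p0] lp_norm_powr[OF V(2) p0] by (intro suminf_add S V)
  also have "\<dots> \<le> (\<Sum>n. 2 * \<bar>x n\<bar> powr p + 2 * \<bar>y n\<bar> powr p)"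
  proof (intro suminf_le summable_add summable_mult S V x y)
    show "\<bar>(x + y) n\<bar> powr p + \<bar>(x - y) n\<bar> powr p \<le> 2 * \<bar>x n\<bar> powr p + 2 * \<bar>y n\<bar> powr p" for n
      using powr_two_point[OF p0 p(2), of "x n" "y n"] by simp
  qed
  also have "\<dots> = 2 * lp_norm p x powr p + 2 * lp_norm p y powr p"
    unfolding lp_norm_powr[OF x p0] lp_norm_powr[OF y p0]
    by (simp add: suminf_add[symmetric] suminf_mult summable_mult S x y)
  finally show "lp_norm p (x + y) powr p + lp_norm p (x - y) powr p \<le> 2 * lp_norm p x powr p + 2 * lp_norm p y powr p" .
qed

section \<open>Admissibility of the norms of partial sum operators\<close>
lemma admissible_antimono:
  assumes a: "admissible F p a" and s: "s \<le> p" and ge1: "\<And>n. 1 \<le> a n"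
  shows "admissible F s a"
  unfolding admissible_def
proof (intro conjI allI impI)
  show "0 < a n" for n using a unfolding admissible_def by blast
  fix I assume "stationary F I"
  then have "(\<Sum>\<^sub>\<infinity>n\<in>I. ennreal (a n powr (- p))) = \<infinity>" using a unfolding admissible_def by blast
  moreover have "(\<Sum>\<^sub>\<infinity>n\<in>I. ennreal (a n powr (- p))) \<le> (\<Sum>\<^sub>\<infinity>n\<in>I. ennreal (a n powr (- s)))"
    using s ge1 by (intro infsum_mono nonneg_summable_on_complete ennreal_leI powr_mono) auto
  ultimately show "(\<Sum>\<^sub>\<infinity>n\<in>I. ennreal (a n powr (- s))) = \<infinity>" by (simp add: top_unique)
qed

theorem theorem4p3:
  fixes F :: "nat filter"
  assumes "free_filter F"
  shows
    "(\<forall>(V :: 'a::real_vector set) nrm u.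
        banach_on V nrm \<and> infinite_dimensional V \<and>
        filter_basis F V nrm u \<and> continuous_coords F V nrm u \<longrightarrow>
        admissible F 1 (\<lambda>n. onorm_on V nrm (partial_sum F V nrm u n))) \<and>
     (\<forall>u. filter_basis F (lp 2) (lp_norm 2) u \<and> continuous_coords F (lp 2) (lp_norm 2) u \<longrightarrow>
        admissible F 2 (\<lambda>n. onorm_on (lp 2) (lp_norm 2) (partial_sum F (lp 2) (lp_norm 2) u n))) \<and>
     (\<forall>p u. 1 < p \<and> p < 2 \<and>
        filter_basis F (lp p) (lp_norm p) u \<and> continuous_coords F (lp p) (lp_norm p) u \<longrightarrow>
        (\<forall>s. 1 \<le> s \<and> s < p \<longrightarrow>
          admissible F s (\<lambda>n. onorm_on (lp p) (lp_norm p) (partial_sum F (lp p) (lp_norm p) u n))))"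
proof (intro conjI allI impI; elim conjE)
  fix V :: "'a set" and nrm u
  assume B: "banach_on V nrm" and b: "filter_basis F V nrm u" "continuous_coords F V nrm u"
  interpret normed_filter_basis V nrm F u
    using B b assms unfolding banach_on_def by unfold_locales auto
  show "admissible F 1 (\<lambda>n. onorm_on V nrm (partial_sum F V nrm u n))"
    using B by (intro smooth_imp_admissible smooth_on_1) (auto simp: banach_on_def)
next
  fix u assume b: "filter_basis F (lp 2) (lp_norm 2) u" "continuous_coords F (lp 2) (lp_norm 2) u"
  have B: "banach_on (lp 2) (lp_norm 2)" by (rule banach_on_lp) simp
  interpret normed_filter_basis "lp 2" "lp_norm 2" F u
    using B b assms unfolding banach_on_def by unfold_locales auto
  show "admissible F 2 (\<lambda>n. onorm_on (lp 2) (lp_norm 2) (partial_sum F (lp 2) (lp_norm 2) u n))"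
    using B by (intro smooth_imp_admissible smooth_on_lp) (auto simp: banach_on_def)
next
  fix p s :: real and u assume p: "1 < p" "p < 2" and s: "1 \<le> s" "s < p"
    and b: "filter_basis F (lp p) (lp_norm p) u" "continuous_coords F (lp p) (lp_norm p) u"
  have B: "banach_on (lp p) (lp_norm p)" using p by (intro banach_on_lp) simp
  interpret normed_filter_basis "lp p" "lp_norm p" F u
    using B b assms unfolding banach_on_def by unfold_locales auto
  have "admissible F p (\<lambda>n. onorm_on (lp p) (lp_norm p) (partial_sum F (lp p) (lp_norm p) u n))"
    using B p by (intro smooth_imp_admissible smooth_on_lp) (auto simp: banach_on_def)
  then show "admissible F s (\<lambda>n. onorm_on (lp p) (lp_norm p) (partial_sum F (lp p) (lp_norm p) u n))"
    using s onorm_psum_ge_1 by (intro admissible_antimono[where p = p and s = s]) auto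
qed

end
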